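(* Let $k$ be a field of characteristic zero, let $n\geq 2$, and let $m\geq 2$ and $\alpha\geq 1$ be integers. Let $R_n=k[x_1,x_2,\dots,x_n]$ be the polynomial ring in $n$ variables over $k$, and let $d_n$ be the $k$-derivation of $R_n$ given by $$d_n=(1-x_1x_2^{\alpha})\partial_{x_1}+x_1^m\partial_{x_2}+x_2\partial_{x_3}+\dots+x_{n-1}\partial_{x_n}.$$ Then $d_n$ is a simple $k$-derivation of $R_n$, and $d_n(R_n)$ does not contain any unit of $R_n$.
   Context: A $k$-derivation of a commutative $k$-algebra $R$ is a $k$-linear map $d:R\to R$ with $d(ab)=a\,d(b)+d(a)\,b$ for all $a,b\in R$. It is called simple if $R$ has no proper non-zero ideal $I$ with $d(I)\subseteq I$. Here $\partial_{x_i}$ denotes the partial derivative with respect to $x_i$. The derivation $d_n$ is the one with $d_n(x_1)=1-x_1x_2^{\alpha}$, $d_n(x_2)=x_1^m$, and $d_n(x_i)=x_{i-1}$ for $3\leq i\leq n$ (for $n=2$ only the first two terms occur). *)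

theory Defs
  imports "HOL-Library.Poly_Mapping" "HOL-Algebra.Module" "HOL-Algebra.Ideal"
begin

section \<open>Simple derivations of commutative algebras\<close>

locale k_derivation = algebra K R
  for K (structure) and R (structure) +
  fixes d
  assumes d_closed: "a \<in> carrier R \<Longrightarrow> d a \<in> carrier R"
    and d_add: "\<lbrakk>a \<in> carrier R; b \<in> carrier R\<rbrakk> \<Longrightarrow> d (a \<oplus>\<^bsub>R\<^esub> b) = d a \<oplus>\<^bsub>R\<^esub> d b"
    and d_smult: "\<lbrakk>c \<in> carrier K; a \<in> carrier R\<rbrakk> \<Longrightarrow> d (c \<odot>\<^bsub>R\<^esub> a) = c \<odot>\<^bsub>R\<^esub> d a"
    and d_mult: "\<lbrakk>a \<in> carrier R; b \<in> carrier R\<rbrakk> \<Longrightarrow>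
      d (a \<otimes>\<^bsub>R\<^esub> b) = (a \<otimes>\<^bsub>R\<^esub> d b) \<oplus>\<^bsub>R\<^esub> (d a \<otimes>\<^bsub>R\<^esub> b)"

locale simple_k_derivation = k_derivation +
  assumes simple: "\<lbrakk>ideal I R; d ` I \<subseteq> I\<rbrakk> \<Longrightarrow> I = {\<zero>\<^bsub>R\<^esub>} \<or> I = carrier R"


section \<open>The polynomial ring in the variables with indices 1, ..., n\<close>

text \<open>
  A monomial is its finitely supported exponent function \<^typ>\<open>nat \<Rightarrow>\<^sub>0 nat\<close>, and a polynomial
  is a finitely supported coefficient function on monomials, so the type below is the
  polynomial ring in countably many variables, with the ring operations of
  \<^theory>\<open>HOL-Library.Poly_Mapping\<close>. The ring in \<open>n\<close> variables is cut out by a carrier set.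
\<close>

type_synonym 'k mpoly = "(nat \<Rightarrow>\<^sub>0 nat) \<Rightarrow>\<^sub>0 'k"

definition Const :: "'k::zero \<Rightarrow> 'k mpoly" where
  "Const c = Poly_Mapping.single 0 c"

definition Var :: "nat \<Rightarrow> 'k::zero_neq_one mpoly" where
  "Var i = Poly_Mapping.single (Poly_Mapping.single i 1) 1"

definition coeff_field :: "'k::field ring" where
  "coeff_field = \<lparr>carrier = UNIV, mult = (*), one = 1, zero = 0, add = (+)\<rparr>"

definition mpoly_algebra :: "nat \<Rightarrow> ('k::field, 'k mpoly) module" where
  "mpoly_algebra n =
    \<lparr>carrier = {p. \<forall>e \<in> Poly_Mapping.keys p. Poly_Mapping.keys e \<subseteq> {1..n}},
     mult = (*), one = 1, zero = 0, add = (+), smult = (\<lambda>c p. Const c * p)\<rparr>"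

text \<open>
  In the summand where the exponent of the \<open>i\<close>-th variable is \<open>0\<close>, the (truncated) difference
  of exponents does no harm because the coefficient vanishes.
\<close>

definition partial_deriv :: "nat \<Rightarrow> 'k::field mpoly \<Rightarrow> 'k mpoly" where
  "partial_deriv i p = (\<Sum>e \<in> Poly_Mapping.keys p.
     Poly_Mapping.single (e - Poly_Mapping.single i 1)
       (of_nat (Poly_Mapping.lookup e i) * Poly_Mapping.lookup p e))"

definition d_n :: "nat \<Rightarrow> nat \<Rightarrow> nat \<Rightarrow> 'k::field mpoly \<Rightarrow> 'k mpoly" where
  "d_n n m \<alpha> p =
     (1 - Var 1 * Var 2 ^ \<alpha>) * partial_deriv 1 p + Var 1 ^ m * partial_deriv 2 p
     + (\<Sum>i = 3..n. Var (i - 1) * partial_deriv i p)"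

end

theory Submission
  imports Defs "HOL-Computational_Algebra.Polynomial_Factorial"
begin

text \<open>
  Write \<open>x, y\<close> for \<open>x\<^sub>1, x\<^sub>2\<close> and \<open>d = d\<^sub>2\<close>, and put \<open>t = x y\<^sup>\<alpha>\<close>.

  Suppose \<open>d f = h f\<close> with \<open>f \<noteq> 0\<close>. Give \<open>x\<close> weight \<open>- \<alpha>\<close> and \<open>y\<close> weight \<open>1\<close>, so that the part of
  \<open>f\<close> of weight \<open>w\<close> is \<open>y\<^sup>w F\<^sub>w(t)\<close>. On these parts \<open>(1 - x y\<^sup>\<alpha>) \<partial>\<^sub>x\<close> acts as \<open>(1 - t) \<partial>\<^sub>t\<close>, and
  \<open>x\<^sup>m \<partial>\<^sub>y\<close> only enters \<open>M = m \<alpha> + \<alpha> + 1\<close> weights further down. The top part, of weight \<open>\<delta>\<close>, is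
  therefore \<open>y\<^sup>\<delta> (1 - t)\<^sup>p\<close> up to a constant. Each further monomial of \<open>h\<close> would prevent the
  equation in its weight from being solvable at \<open>t = 1\<close>, so \<open>h = - p y\<^sup>\<alpha>\<close>; and the equation \<open>M\<close>
  weights below the top is solvable at \<open>t = 1\<close> only if \<open>\<delta> + (m + 1) p \<alpha> = 0\<close>. Hence
  \<open>\<delta> = p = 0\<close> and \<open>d f = 0\<close>.

  If \<open>d f\<close> lies in \<open>k[y]\<close>, in particular if \<open>d f = 0\<close>, then \<open>f\<close> is constant. Here the weights
  are \<open>\<alpha> + 1\<close> for \<open>x\<close> and \<open>m\<close> for \<open>y\<close>, for which the top part of \<open>f\<close> is a multiple of a power of
  \<open>x\<^sup>m / m + y\<^sup>\<alpha>\<^sup>+\<^sup>1 / (\<alpha> + 1)\<close>; the positivity of its coefficients contradicts the equation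
  for the next part.

  In a non-zero \<open>d\<close>-stable ideal, an element of least degree in \<open>x\<close>, after division by its content,
  divides its derivative by Gauss's lemma, hence is constant. So the ideal contains a non-zero
  element of \<open>k[y]\<close>, and then \<open>x\<^sup>a\<close> for some \<open>a\<close>, and then \<open>1\<close>.

  For \<open>n \<ge> 3\<close> write \<open>R\<^sub>n = R\<^sub>n\<^sub>-\<^sub>1[x\<^sub>n]\<close>. Comparing the two highest coefficients in \<open>x\<^sub>n\<close> shows by
  induction that \<open>d\<^sub>n h = c x\<^sub>n + c'\<close> is possible for constant \<open>h\<close> only. For a non-zero stable
  ideal, the leading coefficients of its elements of least degree \<open>N\<close> in \<open>x\<^sub>n\<close> form a stable ideal
  of \<open>R\<^sub>n\<^sub>-\<^sub>1\<close>, so it contains a monic element of degree \<open>N\<close>; its derivative has smaller degree and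
  vanishes, which by the first point forces \<open>N = 0\<close>.
\<close>

section \<open>The derivation in two variables\<close>

text \<open>
  \<open>k[x, y]\<close> is represented as \<^typ>\<open>'k poly poly\<close> with outer variable \<open>x\<close> and inner variable \<open>y\<close>.
  The \<open>y\<close>-exponents in \<open>bcoeff\<close> are integers so that they can be shifted freely.
\<close>

definition bcoeff :: "'k::zero poly poly \<Rightarrow> nat \<Rightarrow> int \<Rightarrow> 'k" where
  "bcoeff f i j = (if j < 0 then 0 else coeff (coeff f i) (nat j))"

definition bideriv :: "nat \<Rightarrow> nat \<Rightarrow> 'k::field_char_0 poly poly \<Rightarrow> 'k poly poly" where
  "bideriv m \<alpha> f =
     (1 - monom (monom 1 \<alpha>) 1) * pderiv f + monom 1 m * map_poly pderiv f"

lemma bcoeff_eqI: "(\<And>i j. bcoeff f i (int j) = bcoeff g i (int j)) \<Longrightarrow> f = g"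
  by (simp add: bcoeff_def poly_eq_iff)

lemma bcoeff_neg: "j < 0 \<Longrightarrow> bcoeff f i j = 0"
  by (simp add: bcoeff_def)

lemma bcoeff_0 [simp]: "bcoeff 0 i j = 0"
  by (simp add: bcoeff_def)

lemma bcoeff_add: "bcoeff (f + g) i j = bcoeff f i j + bcoeff g i j"
  by (simp add: bcoeff_def)

lemma bcoeff_diff: "bcoeff (f - g) i j = bcoeff f i j - bcoeff g i (j::int)"
    for f g :: "'k::ab_group_add poly poly"
  by (simp add: bcoeff_def)

lemma finite_bcoeff: "finite {(i, j). bcoeff f i j \<noteq> 0}"
proof (rule finite_subset)
  show "{(i, j). bcoeff f i j \<noteq> 0} \<subseteq> (SIGMA i:{..degree f}. {0..int (degree (coeff f i))})"
    by (auto simp: bcoeff_def split: if_splits intro!: le_degree)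
       (metis le_degree nat_le_iff)
qed auto

lemma bcoeff_mult:
  "bcoeff (f * g) i j = (\<Sum>k\<le>i. \<Sum>l\<in>{0..j}. bcoeff f k l * bcoeff g (i - k) (j - l))"
proof (cases "j < 0")
  case False
  have "(\<Sum>l\<in>{0..j}. bcoeff f k l * bcoeff g (i - k) (j - l))
      = (\<Sum>l\<le>nat j. coeff (coeff f k) l * coeff (coeff g (i - k)) (nat j - l))" for k
    by (rule sum.reindex_bij_witness[of _ int nat])
       (use False in \<open>auto simp: bcoeff_def nat_diff_distrib\<close>)
  then show ?thesis
    using False by (simp add: bcoeff_def coeff_mult coeff_sum)
qed (simp add: bcoeff_neg)

lemma bcoeff_mult_nonzero:
  assumes "bcoeff (f * g) i j \<noteq> 0"
  obtains k l where "k \<le> i" "bcoeff f k l \<noteq> 0" "bcoeff g (i - k) (j - l) \<noteq> 0"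
proof -
  obtain k where "k \<le> i" "(\<Sum>l\<in>{0..j}. bcoeff f k l * bcoeff g (i - k) (j - l)) \<noteq> 0"
    using assms unfolding bcoeff_mult by (metis (no_types, lifting) atMost_iff sum.neutral)
  moreover from this obtain l where "bcoeff f k l * bcoeff g (i - k) (j - l) \<noteq> 0"
    by (meson sum.not_neutral_contains_not_neutral)
  ultimately show ?thesis
    using that[of k l] by (metis mult_zero_left mult_zero_right)
qed

lemma bcoeff_monom_mult:
  "bcoeff (monom (monom c l) k * f) i j = (if k \<le> i then c * bcoeff f (i - k) (j - int l) else 0)"
  by (auto simp: bcoeff_def coeff_monom_mult nat_diff_distrib' nat_less_iff)

lemma bcoeff_pderiv: "bcoeff (pderiv f) i j = of_nat (i + 1) * bcoeff f (i + 1) j"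
  by (simp add: bcoeff_def coeff_pderiv of_nat_poly)

lemma bcoeff_map_pderiv: "bcoeff (map_poly pderiv f) i j = of_int (j + 1) * bcoeff f i (j + 1)"
proof (cases "j < 0")
  case True
  then show ?thesis by (cases "j = -1") (auto simp: bcoeff_def)
next
  case False
  then have "nat (j + 1) = Suc (nat j)" "(of_int (j + 1) :: 'a) = of_nat (Suc (nat j))"
    by auto
  with False show ?thesis
    by (simp add: bcoeff_def coeff_map_poly coeff_pderiv del: of_int_add of_nat_Suc)
qed

text \<open>The three terms come from d/dx, -x y^\<alpha> d/dx and x^m d/dy. The weight arguments
  below start from this formula.\<close>

lemma bcoeff_bideriv:
  "bcoeff (bideriv m \<alpha> f) i j =
     of_nat (i + 1) * bcoeff f (i + 1) j - of_nat i * bcoeff f i (j - int \<alpha>)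
     + (if m \<le> i then of_int (j + 1) * bcoeff f (i - m) (j + 1) else 0)"
proof -
  have "bcoeff (monom 1 m * map_poly pderiv f) i j
      = (if m \<le> i then of_int (j + 1) * bcoeff f (i - m) (j + 1) else 0)"
    using bcoeff_monom_mult[of 1 0 m "map_poly pderiv f" i j]
    by (simp add: bcoeff_map_pderiv flip: one_poly_eq_simps(1))
  moreover have "bcoeff (monom (monom 1 \<alpha>) 1 * pderiv f) i j = of_nat i * bcoeff f i (j - int \<alpha>)"
    by (subst bcoeff_monom_mult) (auto simp: bcoeff_pderiv)
  ultimately show ?thesis
    by (simp add: bideriv_def left_diff_distrib bcoeff_add bcoeff_diff bcoeff_pderiv)
qed

lemma bideriv_add: "bideriv m \<alpha> (f + g) = bideriv m \<alpha> f + bideriv m \<alpha> g"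
  by (rule bcoeff_eqI) (simp add: bcoeff_bideriv bcoeff_add algebra_simps)

lemma pderiv_sum: "pderiv (sum f A) = (\<Sum>x\<in>A. pderiv (f x))"
  by (induction A rule: infinite_finite_induct) (simp_all add: pderiv_add)

lemma map_poly_pderiv_mult:
  "map_poly pderiv (f * g) = map_poly pderiv f * g + f * map_poly pderiv g"
  for f g :: "'k::field_char_0 poly poly"
proof (rule poly_eqI)
  fix n
  have "coeff (map_poly pderiv (f * g)) n
      = (\<Sum>i\<le>n. pderiv (coeff f i) * coeff g (n - i) + coeff f i * pderiv (coeff g (n - i)))"
    by (simp add: coeff_map_poly coeff_mult pderiv_sum pderiv_mult add.commute mult.commute)
  also have "\<dots> = coeff (map_poly pderiv f * g + f * map_poly pderiv g) n"
    by (simp add: coeff_map_poly coeff_mult sum.distrib)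
  finally show "coeff (map_poly pderiv (f * g)) n
      = coeff (map_poly pderiv f * g + f * map_poly pderiv g) n" .
qed

lemma bideriv_mult: "bideriv m \<alpha> (f * g) = f * bideriv m \<alpha> g + bideriv m \<alpha> f * g"
  by (simp add: bideriv_def pderiv_mult map_poly_pderiv_mult algebra_simps)

lemma coeff_1_linear_power: "coeff ([:1, 1:] ^ n) 1 = (of_nat n :: 'k::comm_ring_1)"
  by (induction n) (auto simp: coeff_pCons coeff_0_power split: nat.splits)

section \<open>Elements with derivative in \<open>k[y]\<close>\<close>

lemma finite_ex_max:
  fixes \<phi> :: "'a \<Rightarrow> 'b::linorder"
  assumes "finite S" "S \<noteq> {}"
  obtains x where "x \<in> S" "\<And>y. y \<in> S \<Longrightarrow> \<phi> y \<le> \<phi> x"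
proof -
  have "Max (\<phi> ` S) \<in> \<phi> ` S"
    using assms by simp
  then obtain x where "x \<in> S" "\<phi> x = Max (\<phi> ` S)"
    by auto
  then show ?thesis
    using that[of x] assms by auto
qed

lemma ex_max_bcoeff:
  fixes \<phi> :: "nat \<Rightarrow> int \<Rightarrow> 'b::linorder"
  assumes "f \<noteq> 0"
  obtains i j where "bcoeff f i j \<noteq> 0" "\<And>k l. bcoeff f k l \<noteq> 0 \<Longrightarrow> \<phi> k l \<le> \<phi> i j"
proof -
  have "{(i, j). bcoeff f i j \<noteq> 0} \<noteq> {}"
    using assms bcoeff_eqI[of f 0] by auto
  then obtain x where "x \<in> {(i, j). bcoeff f i j \<noteq> 0}"
    "\<And>y. y \<in> {(i, j). bcoeff f i j \<noteq> 0} \<Longrightarrow> case_prod \<phi> y \<le> case_prod \<phi> x"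
    using finite_ex_max[OF finite_bcoeff, of f "case_prod \<phi>"] by metis
  then show ?thesis
    using that[of "fst x" "snd x"] by (fastforce simp: case_prod_unfold)
qed

lemma ex_lex_max_bcoeff:
  fixes \<phi> \<psi> :: "nat \<Rightarrow> int \<Rightarrow> 'b::linorder"
  assumes "f \<noteq> 0"
  obtains i j where "bcoeff f i j \<noteq> 0"
    "\<And>k l. bcoeff f k l \<noteq> 0 \<Longrightarrow> \<phi> k l < \<phi> i j \<or> \<phi> k l = \<phi> i j \<and> \<psi> k l \<le> \<psi> i j"
proof -
  obtain i0 j0 where max: "bcoeff f i0 j0 \<noteq> 0" "\<And>k l. bcoeff f k l \<noteq> 0 \<Longrightarrow> \<phi> k l \<le> \<phi> i0 j0"
    using ex_max_bcoeff[OF assms, of \<phi>] by metis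
  let ?S = "{x \<in> {(i, j). bcoeff f i j \<noteq> 0}. case_prod \<phi> x = \<phi> i0 j0}"
  have "finite ?S" "?S \<noteq> {}"
    using finite_bcoeff[of f] max by auto
  then obtain x where x: "x \<in> ?S" "\<And>y. y \<in> ?S \<Longrightarrow> case_prod \<psi> y \<le> case_prod \<psi> x"
    using finite_ex_max[of ?S "case_prod \<psi>"] by blast
  show ?thesis
  proof (rule that)
    show "bcoeff f (fst x) (snd x) \<noteq> 0"
      using x(1) by auto
    fix k l assume kl: "bcoeff f k l \<noteq> 0"
    have eq: "\<phi> (fst x) (snd x) = \<phi> i0 j0"
      using x(1) by auto
    show "\<phi> k l < \<phi> (fst x) (snd x)
        \<or> \<phi> k l = \<phi> (fst x) (snd x) \<and> \<psi> k l \<le> \<psi> (fst x) (snd x)"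
    proof (cases "\<phi> k l = \<phi> i0 j0")
      case True
      then show ?thesis
        using x(2)[of "(k, l)"] kl eq by (simp add: case_prod_unfold)
    next
      case False
      then show ?thesis
        using max(2)[OF kl] eq by simp
    qed
  qed
qed

text \<open>For weights \<alpha> + 1 of x and m of y, both -x y^\<alpha> d/dx and x^m d/dy raise the
  weight by m \<alpha>, whereas d/dx lowers it by \<alpha> + 1. The top part therefore satisfies a
  homogeneous recurrence, and its d/dx drives the part m \<alpha> + \<alpha> + 1 weights below. Only
  exponents i \<ge> 1 of x are constrained, so any element of k[y] is allowed as derivative.\<close>

lemma bideriv_free_imp_const:
  fixes f :: "'k::field_char_0 poly poly"
  assumes m: "m \<ge> 2" and \<alpha>: "\<alpha> \<ge> 1"
    and free: "\<And>i. i \<ge> 1 \<Longrightarrow> coeff (bideriv m \<alpha> f) i = 0"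
  shows "\<exists>c. f = [:[:c:]:]"
proof (cases "f = 0")
  case True
  then show ?thesis by (intro exI[of _ 0]) simp
next
  case False
  define \<beta> where "\<beta> = \<alpha> + 1"
  have eq: "of_nat (i + 1) * bcoeff f (i + 1) j - of_nat i * bcoeff f i (j - int \<alpha>)
     + (if m \<le> i then of_int (j + 1) * bcoeff f (i - m) (j + 1) else 0) = 0" if "i \<ge> 1" for i j
    using bcoeff_bideriv[of m \<alpha> f i j] free[OF that]
    by (metis bcoeff_def coeff_0)
  obtain i0 N where i0: "bcoeff f i0 N \<noteq> 0" and
    max: "\<And>k l. bcoeff f k l \<noteq> 0 \<Longrightarrow>
       int (\<beta> * k) + int m * l < int (\<beta> * i0) + int m * N
       \<or> int (\<beta> * k) + int m * l = int (\<beta> * i0) + int m * N \<and> l \<le> N"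
    using ex_lex_max_bcoeff[OF False, of "\<lambda>k l. int (\<beta> * k) + int m * l" "\<lambda>k l. l"] by metis
  have zero: "bcoeff f k l = 0"
    if "int (\<beta> * k) + int m * l > int (\<beta> * i0) + int m * N
       \<or> int (\<beta> * k) + int m * l \<ge> int (\<beta> * i0) + int m * N \<and> l > N" for k l
    using max[of k l] that by linarith
  \<comment> \<open>Otherwise the coefficient of \<open>x^i0 y^(N + \<alpha>)\<close> in the
    derivative is minus \<open>i0\<close> times that of the chosen monomial: the other two terms
    involve a larger weight or, at equal weight, a larger exponent of y.\<close>
  have "i0 = 0"
  proof (rule ccontr)
    assume "i0 \<noteq> 0"
    have "bcoeff f (i0 + 1) (N + int \<alpha>) = 0"
      by (rule zero) (use m in \<open>auto simp: \<beta>_def algebra_simps\<close>)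
    moreover have "bcoeff f (i0 - m) (N + int \<alpha> + 1) = 0" if "m \<le> i0"
    proof (rule zero)
      have "int (\<beta> * (i0 - m)) + int m * (N + int \<alpha> + 1) = int (\<beta> * i0) + int m * N"
        using le_Suc_ex[OF that] by (auto simp: \<beta>_def algebra_simps)
      then show "int (\<beta> * (i0 - m)) + int m * (N + int \<alpha> + 1) > int (\<beta> * i0) + int m * N
        \<or> int (\<beta> * (i0 - m)) + int m * (N + int \<alpha> + 1) \<ge> int (\<beta> * i0) + int m * N \<and> N + int \<alpha>
            + 1 > N"
        by simp
    qed
    ultimately show False
      using eq[of i0 "N + int \<alpha>"] i0 \<open>i0 \<noteq> 0\<close> by (auto split: if_splits)
  qed
  have "N \<ge> 0"
    using i0 by (meson bcoeff_neg not_less)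
  define n where "n = nat N"
  have N: "N = int n"
    using \<open>N \<ge> 0\<close> by (simp add: n_def)
  have zero': "bcoeff f k l = 0" if "int (\<beta> * k) + int m * l > int (m * n)" for k l
    using zero[of k l] that \<open>i0 = 0\<close> N by simp
  \<comment> \<open>\<open>a\<close> lists the coefficients of the top part, \<open>u\<close> those of the next part coupled to it.\<close>
  define a where "a = (\<lambda>q. bcoeff f (m * q) (int n - int (\<beta> * q)))"
  define u where "u = (\<lambda>q. if q = 0 then 0 else bcoeff f (m * q - 1) (int n - int (\<beta> * q) - int \<alpha>))"
  have a0: "a 0 \<noteq> 0"
    using i0 by (simp add: a_def \<open>i0 = 0\<close> N)
  \<comment> \<open>From the coefficient of \<open>x^(m (q + 1)) y^(n - \<beta> q - 1)\<close>; the
    d/dx term refers to a weight above the top one.\<close>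
  have rec_a: "of_nat (m * (q + 1)) * a (q + 1) = of_int (int n - int (\<beta> * q)) * a q" for q
  proof -
    have "bcoeff f (m * (q + 1) + 1) (int n - int (\<beta> * q) - 1) = 0"
      by (rule zero') (simp add: \<beta>_def algebra_simps add_pos_nonneg)
    moreover have "int n - int (\<beta> * q) - 1 - int \<alpha> = int n - int (\<beta> * (q + 1))"
      by (simp add: \<beta>_def algebra_simps)
    moreover have ge: "m * (q + 1) \<ge> 1" "m \<le> m * (q + 1)" "m * (q + 1) - m = m * q"
      "int n - int (\<beta> * q) - 1 + 1 = int n - int (\<beta> * q)"
      using m by auto
    ultimately have "of_nat (m * (q + 1) + 1) * 0 - of_nat (m * (q + 1)) * a (q + 1)
        + of_int (int n - int (\<beta> * q)) * a q = 0"
      using eq[OF ge(1), of "int n - int (\<beta> * q) - 1"] by (simp only: a_def if_True)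
    then show ?thesis
      by (simp only: mult_zero_right diff_0 add_eq_0_iff minus_minus)
  qed
  \<comment> \<open>From the coefficient of
    \<open>x^(m (q + 1) - 1) y^(n - \<beta> (q + 1))\<close>, whose exponent of x is positive by m
    \<ge> 2. For q = 0 the convention \<open>u 0 = 0\<close> stands for the missing x^m d/dy
    term.\<close>
  have rec_u: "of_nat (m * (q + 1) - 1) * u (q + 1)
      = of_nat (m * (q + 1)) * a (q + 1) + of_int (int n - int (\<beta> * (q + 1)) + 1) * u q" for q
  proof -
    have ge: "m * (q + 1) - 1 \<ge> 1"
      using m by simp
    have suc: "m * (q + 1) - 1 + 1 = m * (q + 1)"
      using m by simp
    have "(if m \<le> m * (q + 1) - 1 then
        of_int (int n - int (\<beta> * (q + 1)) + 1)
            * bcoeff f (m * (q + 1) - 1 - m) (int n - int (\<beta> * (q + 1)) + 1) else 0)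
      = of_int (int n - int (\<beta> * (q + 1)) + 1) * u q"
    proof (cases q)
      case 0
      then show ?thesis using m by (simp add: u_def)
    next
      case (Suc q')
      have "m \<le> m * (q + 1) - 1" "m * (q + 1) - 1 - m = m * q - 1"
        using m Suc by (auto simp: algebra_simps)
      moreover have "int n - int (\<beta> * (q + 1)) + 1 = int n - int (\<beta> * q) - int \<alpha>"
        by (simp add: \<beta>_def algebra_simps)
      moreover have "u q = bcoeff f (m * q - 1) (int n - int (\<beta> * q) - int \<alpha>)"
        using Suc by (simp add: u_def)
      ultimately show ?thesis
        by (simp only: if_True)
    qed
    moreover have "u (q + 1) = bcoeff f (m * (q + 1) - 1) (int n - int (\<beta> * (q + 1)) - int \<alpha>)"
      by (simp add: u_def)
    ultimately have "of_nat (m * (q + 1)) * a (q + 1) - of_nat (m * (q + 1) - 1) * u (q + 1)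
        + of_int (int n - int (\<beta> * (q + 1)) + 1) * u q = 0"
      using eq[OF ge, of "int n - int (\<beta> * (q + 1))"] unfolding suc by (simp only: a_def)
    moreover have "b = a + c" if "a - b + c = 0" for a b c :: 'k
      using that by (simp add: diff_add_eq)
    ultimately show ?thesis
      by blast
  qed
  \<comment> \<open>The field has no order, so positivity is expressed by rational multiples of
    \<open>a 0\<close>. The factors of both recurrences stay positive in this range.\<close>
  have pos: "\<exists>r s. a q = of_rat r * a 0 \<and> u q = of_rat s * a 0 \<and> r > 0 \<and> s \<ge> 0 \<and> (q \<ge> 1 \<longrightarrow> s > 0)"
    if "\<beta> * q \<le> n" for q
    using that
  proof (induction q)
    case 0
    show ?case by (intro exI[of _ 1] exI[of _ 0]) (simp add: u_def)
  next
    case (Suc q)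
    then obtain r s where rs: "a q = of_rat r * a 0" "u q = of_rat s * a 0" "r > 0" "s \<ge> 0"
      by auto
    have "\<beta> * q < \<beta> * (q + 1)" "\<beta> * (q + 1) \<le> n"
      using Suc.prems by (simp_all add: \<beta>_def)
    then have lt: "\<beta> * q < n" and ge: "int n - int (\<beta> * (q + 1)) + 1 > 0"
      by linarith+
    have mp: "m * (q + 1) - 1 > 0" "m * (q + 1) > 0"
      using m by simp_all
    define r' where "r' = rat_of_int (int n - int (\<beta> * q)) * r / rat_of_nat (m * (q + 1))"
    define s' where "s' = (rat_of_nat (m * (q + 1)) * r'
        + rat_of_int (int n - int (\<beta> * (q + 1)) + 1) * s)
      / rat_of_nat (m * (q + 1) - 1)"
    have nz: "(of_nat (m * (q + 1)) :: 'k) \<noteq> 0" "(of_nat (m * (q + 1) - 1) :: 'k) \<noteq> 0"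
      using mp by (simp_all only: of_nat_eq_0_iff neq0_conv)
    have "a (q + 1) = of_int (int n - int (\<beta> * q)) * a q / of_nat (m * (q + 1))"
      by (simp only: rec_a[symmetric] nonzero_mult_div_cancel_left[OF nz(1)])
    moreover have "u (q + 1) = (of_nat (m * (q + 1)) * a (q + 1)
        + of_int (int n - int (\<beta> * (q + 1)) + 1) * u q)
         / of_nat (m * (q + 1) - 1)"
      by (simp only: rec_u[symmetric] nonzero_mult_div_cancel_left[OF nz(2)])
    moreover from calculation(1) have a': "a (q + 1) = of_rat r' * a 0"
      unfolding r'_def rs of_rat_divide of_rat_mult of_rat_of_nat_eq of_rat_of_int_eq
      by (simp only: times_divide_eq_left mult.assoc)
    ultimately have "u (q + 1) = of_rat s' * a 0"
      unfolding s'_def rs of_rat_divide of_rat_mult of_rat_add of_rat_of_nat_eq of_rat_of_int_eq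
      by (simp only: times_divide_eq_left distrib_right mult.assoc)
    moreover note a'
    moreover have "int n - int (\<beta> * q) > 0" "int n - int (\<beta> * (q + 1)) + 1 \<ge> 0"
      using lt ge by linarith+
    then have P: "rat_of_int (int n - int (\<beta> * q)) > 0"
        "rat_of_int (int n - int (\<beta> * (q + 1)) + 1) \<ge> 0"
      "rat_of_nat (m * (q + 1)) > 0" "rat_of_nat (m * (q + 1) - 1) > 0"
      using mp by (simp_all only: of_nat_0_less_iff of_int_0_less_iff of_int_0_le_iff)
    then have "r' > 0"
      unfolding r'_def using \<open>r > 0\<close> by (intro divide_pos_pos mult_pos_pos)
    moreover have "s' > 0"
      unfolding s'_def using \<open>r' > 0\<close> \<open>s \<ge> 0\<close> P
      by (intro divide_pos_pos add_pos_nonneg mult_pos_pos mult_nonneg_nonneg)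
    ultimately show ?case
      by (intro exI[of _ r'] exI[of _ s']) simp
  qed
  \<comment> \<open>At the last q with \<beta> q \<le> n the next \<open>a\<close> has a negative
    exponent of y, so \<open>rec_a\<close> forces \<beta> q = n. Then \<open>u q\<close> sits at the
    y-exponent -\<alpha> and vanishes, against positivity.\<close>
  have "n = 0"
  proof (rule ccontr)
    assume "n \<noteq> 0"
    define q where "q = n div \<beta>"
    have "\<beta> > 0" by (simp add: \<beta>_def)
    have q: "\<beta> * q \<le> n" "n < \<beta> * (q + 1)"
      unfolding q_def using dividend_less_times_div[OF \<open>\<beta> > 0\<close>, of n] by auto
    obtain r s where rs: "a q = of_rat r * a 0" "u q = of_rat s * a 0" "r > 0" "q \<ge> 1 \<longrightarrow> s > 0"
      using pos[OF q(1)] by blast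
    have "a (q + 1) = 0"
      unfolding a_def by (rule bcoeff_neg) (use q(2) in \<open>simp only: diff_less_0_iff_less
          of_nat_less_iff\<close>)
    then have "of_int (int n - int (\<beta> * q)) * (of_rat r * a 0) = 0"
      using rec_a[of q] rs(1) by (simp only: mult_zero_right)
    then have "int n - int (\<beta> * q) = 0"
      using rs(3) a0 by (simp only: mult_eq_0_iff of_int_eq_0_iff of_rat_eq_0_iff) simp
    then have "\<beta> * q = n"
      by linarith
    then have "q \<ge> 1"
      using \<open>n \<noteq> 0\<close> by (cases q) auto
    moreover have "u q = 0"
      unfolding u_def using \<alpha> \<open>\<beta> * q = n\<close> by (auto intro!: bcoeff_neg)
    ultimately show False
      using rs a0 by auto
  qed
  have "f = [:[:a 0:]:]"
  proof (rule bcoeff_eqI)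
    fix i j
    show "bcoeff f i (int j) = bcoeff [:[:a 0:]:] i (int j)"
    proof (cases "i = 0 \<and> j = 0")
      case True
      then show ?thesis by (simp add: a_def bcoeff_def \<open>n = 0\<close>)
    next
      case False
      then have "bcoeff f i (int j) = 0"
        using m \<open>n = 0\<close> by (intro zero') (auto simp: \<beta>_def simp flip: of_nat_add of_nat_mult)
      then show ?thesis
        using False by (auto simp: bcoeff_def coeff_pCons split: nat.splits)
    qed
  qed
  then show ?thesis by blast
qed

section \<open>Darboux polynomials\<close>

text \<open>Used for leading monomials, whose product cannot be cancelled because it is reached in
  one way only.\<close>

lemma bcoeff_mult_unique:
  assumes nz: "bcoeff f k0 l0 \<noteq> 0" "bcoeff g p q \<noteq> 0"
    and unique: "\<And>k l k' l'. bcoeff f k l \<noteq> 0 \<Longrightarrow> bcoeff g k' l' \<noteq> 0 \<Longrightarrow>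
      k + k' = k0 + p \<Longrightarrow> l + l' = l0 + q \<Longrightarrow> k = k0 \<and> l = l0"
  shows "bcoeff (f * g) (k0 + p) (l0 + q) = bcoeff f k0 l0 * bcoeff g p q"
proof -
  have nonneg: "l0 \<ge> 0" "q \<ge> 0"
    using nz bcoeff_neg by (metis not_less)+
  let ?h = "\<lambda>(k, l). bcoeff f k l * bcoeff g (k0 + p - k) (l0 + q - l)"
  have "bcoeff (f * g) (k0 + p) (l0 + q) = sum ?h ({..k0 + p} \<times> {0..l0 + q})"
    by (simp add: bcoeff_mult sum.cartesian_product)
  also have "\<dots> = sum ?h {(k0, l0)}"
  proof (rule sum.mono_neutral_right)
    show "\<forall>x\<in>{..k0 + p} \<times> {0..l0 + q} - {(k0, l0)}. ?h x = 0"
    proof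
      fix x assume x: "x \<in> {..k0 + p} \<times> {0..l0 + q} - {(k0, l0)}"
      obtain k l where "x = (k, l)"
        by fastforce
      then have "bcoeff f k l = 0 \<or> bcoeff g (k0 + p - k) (l0 + q - l) = 0"
        using unique[of k l "k0 + p - k" "l0 + q - l"] x by auto
      then show "?h x = 0"
        using \<open>x = (k, l)\<close> by auto
    qed
  qed (use nonneg in auto)
  finally show ?thesis
    by simp
qed

text \<open>The leading monomials of \<open>h\<close> and \<open>f\<close> multiply to a monomial of
  \<open>h * f\<close>. Ordering first by x gives k \<le> m, since the derivation raises the degree
  in x by at most m. Ordering first by y gives the rest: only x y^\<alpha> d/dx raises the degree in
  y, by \<alpha>, and it keeps the exponent of x.\<close>

lemma bideriv_cofactor_support:
  fixes f h :: "'k::field_char_0 poly poly"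
  assumes darboux: "bideriv m \<alpha> f = h * f" and "f \<noteq> 0" and kl: "bcoeff h k l \<noteq> 0"
  shows "k \<le> m" "l < int \<alpha> \<or> l = int \<alpha> \<and> k = 0"
proof -
  have "h \<noteq> 0"
    using kl by auto
  have cases: "bcoeff f (i + 1) j \<noteq> 0 \<or> i > 0 \<and> bcoeff f i (j - int \<alpha>) \<noteq> 0
      \<or> m \<le> i \<and> bcoeff f (i - m) (j + 1) \<noteq> 0" if "bcoeff (h * f) i j \<noteq> 0" for i j
    using that unfolding darboux[symmetric] bcoeff_bideriv by (auto split: if_splits)
  show "k \<le> m"
  proof -
    obtain k0 l0 where maxh: "bcoeff h k0 l0 \<noteq> 0"
      "\<And>k l. bcoeff h k l \<noteq> 0 \<Longrightarrow> int k < int k0 \<or> int k = int k0 \<and> l \<le> l0"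
      using ex_lex_max_bcoeff[OF \<open>h \<noteq> 0\<close>, of "\<lambda>k l. int k" "\<lambda>k l. l"] by blast
    obtain p q where maxf: "bcoeff f p q \<noteq> 0"
      "\<And>k l. bcoeff f k l \<noteq> 0 \<Longrightarrow> int k < int p \<or> int k = int p \<and> l \<le> q"
      using ex_lex_max_bcoeff[OF \<open>f \<noteq> 0\<close>, of "\<lambda>k l. int k" "\<lambda>k l. l"] by blast
    have "bcoeff (h * f) (k0 + p) (l0 + q) = bcoeff h k0 l0 * bcoeff f p q"
      by (rule bcoeff_mult_unique[OF maxh(1) maxf(1)]) (drule maxh(2), drule maxf(2), linarith)
    then have "bcoeff (h * f) (k0 + p) (l0 + q) \<noteq> 0"
      using maxh(1) maxf(1) by simp
    then have "k0 \<le> m"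
      using cases[of "k0 + p" "l0 + q"] maxf(2)[of "k0 + p + 1"] maxf(2)[of "k0 + p"] maxf(2)[of
          "k0 + p - m"]
      by fastforce
    then show ?thesis
      using maxh(2)[OF kl] by linarith
  qed
  show "l < int \<alpha> \<or> l = int \<alpha> \<and> k = 0"
  proof -
    obtain k0 l0 where maxh: "bcoeff h k0 l0 \<noteq> 0"
      "\<And>k l. bcoeff h k l \<noteq> 0 \<Longrightarrow> l < l0 \<or> l = l0 \<and> int k \<le> int k0"
      using ex_lex_max_bcoeff[OF \<open>h \<noteq> 0\<close>, of "\<lambda>k l. l" "\<lambda>k l. int k"] by blast
    obtain p q where maxf: "bcoeff f p q \<noteq> 0"
      "\<And>k l. bcoeff f k l \<noteq> 0 \<Longrightarrow> l < q \<or> l = q \<and> int k \<le> int p"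
      using ex_lex_max_bcoeff[OF \<open>f \<noteq> 0\<close>, of "\<lambda>k l. l" "\<lambda>k l. int k"] by blast
    have "l0 \<ge> 0"
      using maxh(1) bcoeff_neg by (metis not_less)
    have "bcoeff (h * f) (k0 + p) (l0 + q) = bcoeff h k0 l0 * bcoeff f p q"
      by (rule bcoeff_mult_unique[OF maxh(1) maxf(1)]) (drule maxh(2), drule maxf(2), linarith)
    then have "bcoeff (h * f) (k0 + p) (l0 + q) \<noteq> 0"
      using maxh(1) maxf(1) by simp
    from cases[OF this] have "l0 < int \<alpha> \<or> l0 = int \<alpha> \<and> k0 = 0"
    proof (elim disjE conjE)
      assume "bcoeff f (k0 + p + 1) (l0 + q) \<noteq> 0"
      from maxf(2)[OF this] \<open>l0 \<ge> 0\<close> show ?thesis by linarith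
    next
      assume "bcoeff f (k0 + p) (l0 + q - int \<alpha>) \<noteq> 0"
      from maxf(2)[OF this] show ?thesis by linarith
    next
      assume "bcoeff f (k0 + p - m) (l0 + q + 1) \<noteq> 0"
      from maxf(2)[OF this] \<open>l0 \<ge> 0\<close> show ?thesis by linarith
    qed
    then show ?thesis
      using maxh(2)[OF kl] by linarith
  qed
qed

text \<open>
  The monomials of \<^term>\<open>f\<close> of a given weight \<^term>\<open>w\<close>, where \<open>x\<close> has weight \<open>- \<alpha>\<close> and \<open>y\<close> has
  weight \<open>1\<close>, form \<open>y\<^sup>w\<close> times a polynomial in \<open>t = x y\<^sup>\<alpha>\<close>; \<open>weight_part\<close> is that polynomial.
\<close>
definition weight_part :: "nat \<Rightarrow> 'k::comm_monoid_add poly poly \<Rightarrow> int \<Rightarrow> 'k poly" where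
  "weight_part \<alpha> f w = (\<Sum>i\<le>degree f. monom (bcoeff f i (w + int \<alpha> * int i)) i)"

lemma coeff_weight_part: "coeff (weight_part \<alpha> f w) i = bcoeff f i (w + int \<alpha> * int i)"
proof -
  have "coeff (weight_part \<alpha> f w) i = (\<Sum>k\<le>degree f.
      if k = i then bcoeff f i (w + int \<alpha> * int i) else 0)"
    unfolding weight_part_def coeff_sum by (rule sum.cong) (auto simp: coeff_monom)
  also have "\<dots> = bcoeff f i (w + int \<alpha> * int i)"
    by (auto simp: bcoeff_def coeff_eq_0)
  finally show ?thesis .
qed

text \<open>Since d/dx t = y^\<alpha>, the operator (1 - t) d/dx sends y^w F(t) to y^(w + \<alpha>)
  (1 - t) F'(t). Since x^m = t^m y^(-m \<alpha>), x^m d/dy lowers weights by m \<alpha> + 1, and y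
  d/dy acts on the part of weight w + M as \<alpha> t d/dt + (w + M).\<close>

lemma weight_part_bideriv:
  fixes f :: "'k::field_char_0 poly poly" and m \<alpha> :: nat
  defines "M \<equiv> int (m * \<alpha> + \<alpha> + 1)"
  shows "weight_part \<alpha> (bideriv m \<alpha> f) (w + int \<alpha>) =
    [:1, -1:] * pderiv (weight_part \<alpha> f w)
    + monom 1 m * (Polynomial.smult (of_nat \<alpha>) (pCons 0 (pderiv (weight_part \<alpha> f (w + M))))
        + Polynomial.smult (of_int (w + M)) (weight_part \<alpha> f (w + M)))"
proof (rule poly_eqI)
  fix i
  have shift: "of_nat \<alpha> * coeff (pCons 0 (pderiv g)) j = of_nat (\<alpha> * j) * coeff g j"
      for g :: "'k poly" and j
    by (cases j) (auto simp: coeff_pderiv algebra_simps)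
  have lin: "coeff ([:1, -1:] * pderiv g) i = of_nat (i + 1) * coeff g (i + 1) - of_nat i
      * coeff g i" for g :: "'k poly"
    by (cases i) (auto simp: coeff_pderiv)
  have M: "w + int \<alpha> + int \<alpha> * int i + 1 = w + M + int \<alpha> * int (i - m)" if "m \<le> i"
    using le_Suc_ex[OF that] by (auto simp: M_def algebra_simps)
  have "(if m \<le> i then of_int (w + int \<alpha> + int \<alpha> * int i + 1)
      * bcoeff f (i - m) (w + int \<alpha> + int \<alpha> * int i + 1) else 0)
     = coeff (monom 1 m * (Polynomial.smult (of_nat \<alpha>) (pCons 0 (pderiv (weight_part \<alpha> f (w + M))))
        + Polynomial.smult (of_int (w + M)) (weight_part \<alpha> f (w + M)))) i"
  proof (cases "m \<le> i")
    case True
    have "(of_int (w + M + int \<alpha> * int (i - m)) :: 'k) = of_nat (\<alpha> * (i - m)) + of_int (w + M)"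
      by simp
    with True show ?thesis
      unfolding M[OF True] coeff_monom_mult coeff_add coeff_smult shift coeff_weight_part
      by (simp only: if_True mult_1 distrib_right leD[OF True] if_False)
  qed (simp add: coeff_monom_mult)
  then show "coeff (weight_part \<alpha> (bideriv m \<alpha> f) (w + int \<alpha>)) i = coeff (
    [:1, -1:] * pderiv (weight_part \<alpha> f w)
    + monom 1 m * (Polynomial.smult (of_nat \<alpha>) (pCons 0 (pderiv (weight_part \<alpha> f (w + M))))
        + Polynomial.smult (of_int (w + M)) (weight_part \<alpha> f (w + M)))) i"
    unfolding coeff_add lin coeff_weight_part bcoeff_bideriv
    by (simp add: algebra_simps)
qed

lemma weight_part_add: "weight_part \<alpha> (f + g) w = weight_part \<alpha> f w + weight_part \<alpha> g w"
  by (rule poly_eqI) (simp add: coeff_weight_part bcoeff_add)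

lemma weight_part_monom_mult:
  "weight_part \<alpha> (monom (monom c l) k * f) w = monom c k
      * weight_part \<alpha> f (w - int l + int \<alpha> * int k)"
proof (rule poly_eqI)
  fix i
  show "coeff (weight_part \<alpha> (monom (monom c l) k * f) w) i
    = coeff (monom c k * weight_part \<alpha> f (w - int l + int \<alpha> * int k)) i"
  proof (cases "k \<le> i")
    case True
    have "w + int \<alpha> * int i - int l = w - int l + int \<alpha> * int k + int \<alpha> * int (i - k)"
      using le_Suc_ex[OF True] by (auto simp: algebra_simps)
    then show ?thesis
      by (simp only: coeff_weight_part bcoeff_monom_mult coeff_monom_mult leD[OF True] True if_True
          if_False)
  qed (simp add: coeff_weight_part bcoeff_monom_mult coeff_monom_mult)
qed

lemma weight_part_eq_0:
  assumes "\<And>k l. bcoeff f k l \<noteq> 0 \<Longrightarrow> l - int \<alpha> * int k < w"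
  shows "weight_part \<alpha> f w = 0"
  by (rule poly_eqI) (use assms in \<open>force simp: coeff_weight_part\<close>)

lemma weight_part_mult_eq_0:
  assumes "\<And>k l. bcoeff f k l \<noteq> 0 \<Longrightarrow> l - int \<alpha> * int k < u"
    and "\<And>k l. bcoeff g k l \<noteq> 0 \<Longrightarrow> l - int \<alpha> * int k \<le> v"
  shows "weight_part \<alpha> (f * g) (u + v) = 0"
proof (rule weight_part_eq_0)
  fix i j assume "bcoeff (f * g) i j \<noteq> 0"
  then obtain k l where "k \<le> i" and kl: "bcoeff f k l \<noteq> 0" "bcoeff g (i - k) (j - l) \<noteq> 0"
    by (rule bcoeff_mult_nonzero)
  have "int \<alpha> * int i = int \<alpha> * int k + int \<alpha> * int (i - k)"
    using \<open>k \<le> i\<close> by (simp add: of_nat_diff algebra_simps)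
  then show "j - int \<alpha> * int i < u + v"
    using assms(1)[OF kl(1)] assms(2)[OF kl(2)] by linarith
qed

lemma bcoeff_monom: "bcoeff (monom (monom c l) k) i j = (if i = k \<and> j = int l then c else 0)"
  by (auto simp: bcoeff_def coeff_monom)

text \<open>Substituting t = 1 + s turns (1 - t) d/dt into -s d/ds, which is diagonal on the powers
  of s.\<close>

lemma pcompose_euler: "pcompose ([:1, -1:] * pderiv q) [:1, 1:] =
    - pCons 0 (pderiv (pcompose q [:1, 1:]))"
  for q :: "'k::field_char_0 poly"
  by (simp only: pcompose_mult) (simp add: pderiv_pcompose pcompose_pCons pderiv_pCons)

lemma coeff_pCons_pderiv: "coeff (pCons 0 (pderiv q)) i = of_nat i * coeff q i"
  for q :: "'k::field_char_0 poly"
  by (cases i) (auto simp: coeff_pderiv)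

lemma pcompose_monom: "pcompose (monom c n) q = Polynomial.smult c (q ^ n)"
    for q :: "'k::comm_semiring_1 poly"
  by (induction n) (simp_all add: monom_0 monom_Suc pcompose_pCons mult.commute)

lemma bideriv_darboux_imp_const:
  fixes f :: "'k::field_char_0 poly poly"
  assumes m: "m \<ge> 2" and \<alpha>: "\<alpha> \<ge> 1" and darboux: "bideriv m \<alpha> f = h * f" and "f \<noteq> 0"
  shows "\<exists>c. f = [:[:c:]:]"
proof -
  define M where "M = int (m * \<alpha> + \<alpha> + 1)"
  have "M > 0"
    unfolding M_def by (simp only: of_nat_0_less_iff add_gr_0 zero_less_one simp_thms)
  define wp where "wp = weight_part \<alpha> f"
  \<comment> \<open>The substitution \<open>t = 1 + s\<close>: then \<open>- s \<partial>\<^sub>s + p\<close> kills the coefficient of \<open>s\<^sup>p\<close>.\<close>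
  define sh :: "'k poly \<Rightarrow> 'k poly" where "sh = (\<lambda>q. pcompose q [:1, 1:])"
  obtain i0 j0 where max: "bcoeff f i0 j0 \<noteq> 0"
    "\<And>k l. bcoeff f k l \<noteq> 0 \<Longrightarrow> l - int \<alpha> * int k \<le> j0 - int \<alpha> * int i0"
    using ex_max_bcoeff[OF \<open>f \<noteq> 0\<close>, of "\<lambda>k l. l - int \<alpha> * int k"] by blast
  define \<delta> where "\<delta> = j0 - int \<alpha> * int i0"
  have le_\<delta>: "l - int \<alpha> * int k \<le> \<delta>" if "bcoeff f k l \<noteq> 0" for k l
    using max(2)[OF that] by (simp add: \<delta>_def)
  have wp_0: "wp w = 0" if "w > \<delta>" for w
    unfolding wp_def by (rule weight_part_eq_0) (use le_\<delta> that in fastforce)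
  define F where "F = wp \<delta>"
  have "coeff F i0 \<noteq> 0"
    using max(1) by (simp add: F_def wp_def coeff_weight_part \<delta>_def)
  have deriv: "weight_part \<alpha> (h * f) (w + int \<alpha>) = [:1, -1:] * pderiv (wp w)
    + monom 1 m * (Polynomial.smult (of_nat \<alpha>) (pCons 0 (pderiv (wp (w + M))))
        + Polynomial.smult (of_int (w + M)) (wp (w + M)))" for w
    unfolding darboux[symmetric] weight_part_bideriv M_def wp_def ..
  \<comment> \<open>By \<open>bideriv_cofactor_support\<close>, y^\<alpha> is the only possible
    monomial of \<open>h\<close> of y-degree \<alpha>. Its weight \<alpha> exceeds the weights of
    all monomials of \<open>h'\<close>.\<close>
  define c0 where "c0 = bcoeff h 0 (int \<alpha>)"
  define h' where "h' = h - monom (monom c0 \<alpha>) 0"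
  have h: "h = monom (monom c0 \<alpha>) 0 + h'"
    by (simp add: h'_def)
  have h'_supp: "k \<le> m \<and> 0 \<le> l \<and> l < int \<alpha>" if "bcoeff h' k l \<noteq> 0" for k l
  proof -
    have "\<not> (k = 0 \<and> l = int \<alpha>)"
      using that by (auto simp: h'_def bcoeff_diff bcoeff_monom c0_def)
    moreover from this have "bcoeff h k l \<noteq> 0"
      using that by (auto simp: h'_def bcoeff_diff bcoeff_monom)
    ultimately show ?thesis
      using bideriv_cofactor_support[OF darboux \<open>f \<noteq> 0\<close>, of k l] bcoeff_neg[of l h k] by fastforce
  qed
  have wp_c0: "weight_part \<alpha> (monom (monom c0 \<alpha>) 0 * f) (w + int \<alpha>) = Polynomial.smult c0 (wp w)"
      for w
    by (simp only: weight_part_monom_mult wp_def) (simp add: monom_0)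
  \<comment> \<open>In the top weight the equation is (1 - t) F' = c0 F. In terms of s, every power
    s^i that occurs in F satisfies -i = c0, so by characteristic zero only one power occurs.\<close>
  have "\<exists>p g. g \<noteq> 0 \<and> c0 = - of_nat p \<and> sh F = monom g p"
  proof -
    have "weight_part \<alpha> (h' * f) (int \<alpha> + \<delta>) = 0"
    proof (rule weight_part_mult_eq_0)
      fix k l assume "bcoeff h' k l \<noteq> 0"
      moreover have "int \<alpha> * int k \<ge> 0" by simp
      ultimately show "l - int \<alpha> * int k < int \<alpha>"
        using h'_supp[of k l] by linarith
    qed (rule le_\<delta>)
    then have "[:1, -1:] * pderiv F = Polynomial.smult c0 F"
      using deriv[of \<delta>] wp_0[of "\<delta> + M"] wp_c0[of \<delta>] \<open>M > 0\<close>
      by (simp add: h distrib_right weight_part_add F_def add.commute)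
    then have "sh ([:1, -1:] * pderiv F) = Polynomial.smult c0 (sh F)"
      by (simp add: sh_def pcompose_smult)
    then have "- pCons 0 (pderiv (sh F)) = Polynomial.smult c0 (sh F)"
      unfolding sh_def pcompose_euler .
    then have eq: "- of_nat i * coeff (sh F) i = c0 * coeff (sh F) i" for i
      by (metis coeff_minus coeff_pCons_pderiv coeff_smult mult_minus_left)
    have "sh F \<noteq> 0"
      using \<open>coeff F i0 \<noteq> 0\<close> by (auto simp: sh_def pcompose_eq_0_iff)
    then obtain p where p: "coeff (sh F) p \<noteq> 0"
      by (metis leading_coeff_0_iff)
    then have c0: "c0 = - of_nat p"
      using eq[of p] by (metis mult_right_cancel)
    have "coeff (sh F) i = 0" if "i \<noteq> p" for i
      using eq[of i] that unfolding c0 by simp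
    then have "sh F = monom (coeff (sh F) p) p"
      by (auto simp: poly_eq_iff coeff_monom)
    with p c0 show ?thesis by blast
  qed
  then obtain p g where g: "g \<noteq> 0" and c0: "c0 = - of_nat p" and shF: "sh F = monom g p"
    by blast
  \<comment> \<open>The equation is compared in weight u + \<delta>, where u is the highest weight
    in \<open>h'\<close>, at the power s^p.\<close>
  have "h' = 0"
  proof (rule ccontr)
    assume "h' \<noteq> 0"
    then obtain k l where kl: "bcoeff h' k l \<noteq> 0"
      "\<And>k' l'. bcoeff h' k' l' \<noteq> 0 \<Longrightarrow> l' - int \<alpha> * int k' \<le> l - int \<alpha> * int k"
      using ex_max_bcoeff[of h' "\<lambda>k l. l - int \<alpha> * int k"] by blast
    define u where "u = l - int \<alpha> * int k"
    define c where "c = bcoeff h' k l"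
    define h'' where "h'' = h' - monom (monom c (nat l)) k"
    have l: "0 \<le> l" "l < int \<alpha>" "k \<le> m"
      using h'_supp[OF kl(1)] by auto
    have "weight_part \<alpha> (h'' * f) (u + \<delta>) = 0"
    proof (rule weight_part_mult_eq_0)
      fix k' l' assume k'l': "bcoeff h'' k' l' \<noteq> 0"
      then have ne: "\<not> (k' = k \<and> l' = l)"
        using l by (auto simp: h''_def bcoeff_diff bcoeff_monom c_def)
      then have "bcoeff h' k' l' \<noteq> 0"
        using k'l' l by (auto simp: h''_def bcoeff_diff bcoeff_monom split: if_splits)
      then have le: "l' - int \<alpha> * int k' \<le> u" and l': "0 \<le> l'" "l' < int \<alpha>"
        using kl(2) h'_supp by (auto simp: u_def)
      \<comment> \<open>Since y-exponents in \<open>h'\<close> lie between 0 and \<alpha> - 1, the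
        weight modulo \<alpha> determines the exponent of y, and then that of x. So
        \<open>h'\<close> has only one monomial of weight u.\<close>
      have "l' - int \<alpha> * int k' \<noteq> u"
      proof
        assume eq: "l' - int \<alpha> * int k' = u"
        have "l' = (l' - int \<alpha> * int k') mod int \<alpha>" "l = (l - int \<alpha> * int k) mod int \<alpha>"
          using l l' by (simp_all add: mod_diff_right_eq[symmetric] del: mod_diff_right_eq)
        then have "l' = l"
          using eq by (simp add: u_def)
        with eq ne \<alpha> show False
          by (simp add: u_def)
      qed
      with le show "l' - int \<alpha> * int k' < u" by linarith
    qed (rule le_\<delta>)
    moreover have "weight_part \<alpha> (monom (monom c (nat l)) k * f) (u + \<delta>) = monom c k * F"
      using l by (simp add: weight_part_monom_mult u_def F_def wp_def)
    moreover have "h * f = monom (monom c0 \<alpha>) 0 * f + (monom (monom c (nat l)) k * f + h'' * f)"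
      by (simp add: h h''_def algebra_simps)
    ultimately have wt: "weight_part \<alpha> (h * f) (u + \<delta>) = Polynomial.smult c0 (wp (u + \<delta> - int \<alpha>))
        + monom c k * F"
      using wp_c0[of "u + \<delta> - int \<alpha>"] by (simp add: weight_part_add)
    \<comment> \<open>By k \<le> m the x^m d/dy term comes from a weight above \<delta> and
      vanishes.\<close>
    have "int \<alpha> * int k \<le> int \<alpha> * int m"
      using l by (simp add: mult_left_mono)
    moreover have "M = int \<alpha> * int m + int \<alpha> + 1"
      by (simp add: M_def)
    ultimately have "u + \<delta> - int \<alpha> + M > \<delta>"
      using l unfolding u_def by linarith
    then have "weight_part \<alpha> (h * f) (u + \<delta>) = [:1, -1:] * pderiv (wp (u + \<delta> - int \<alpha>))"
      using deriv[of "u + \<delta> - int \<alpha>"] wp_0 by simp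
    with wt have "sh ([:1, -1:] * pderiv (wp (u + \<delta> - int \<alpha>)))
      = sh (Polynomial.smult c0 (wp (u + \<delta> - int \<alpha>)) + monom c k * F)"
      by simp
    then have "- pCons 0 (pderiv (sh (wp (u + \<delta> - int \<alpha>))))
      = Polynomial.smult c0 (sh (wp (u + \<delta> - int \<alpha>))) + sh (monom c k) * sh F"
      by (simp only: sh_def pcompose_euler pcompose_add pcompose_mult[of
          "monom c k"] pcompose_smult)
    then have "coeff (- pCons 0 (pderiv (sh (wp (u + \<delta> - int \<alpha>))))) p
      = coeff (Polynomial.smult c0 (sh (wp (u + \<delta> - int \<alpha>))) + sh (monom c k) * sh F) p"
      by simp
    \<comment> \<open>On s^p both -s d/ds and c0 act as multiplication by -p, so the unknown part
      cancels. What remains is g c times the constant term 1 of (1 + s)^k.\<close>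
    then have "0 = coeff (monom g p * Polynomial.smult c ([:1, 1:] ^ k)) p"
      unfolding coeff_minus coeff_add coeff_smult coeff_pCons_pderiv shF c0
      by (simp add: sh_def pcompose_monom mult.commute del: mult_smult_right)
    then have "g * c = 0"
      by (simp add: coeff_monom_mult coeff_0_power del: mult_smult_right)
    then show False
      using g kl(1) by (simp add: c_def)
  qed
  \<comment> \<open>The part of weight \<delta> - M + \<alpha> of the equation, in which x^m d/dy
    acts on the top part F. Its coefficient at s^p is again free of the unknown part.\<close>
  have "Polynomial.smult c0 (wp (\<delta> - M)) = [:1, -1:] * pderiv (wp (\<delta> - M))
    + monom 1 m * (Polynomial.smult (of_nat \<alpha>) ([:0, 1:] * pderiv F)
        + Polynomial.smult (of_int \<delta>) F)"
    using deriv[of "\<delta> - M"] wp_c0[of "\<delta> - M"] by (simp add: h \<open>h' = 0\<close> F_def)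
  then have "sh (Polynomial.smult c0 (wp (\<delta> - M))) = sh ([:1, -1:] * pderiv (wp (\<delta> - M))
    + monom 1 m * (Polynomial.smult (of_nat \<alpha>) ([:0, 1:] * pderiv F)
        + Polynomial.smult (of_int \<delta>) F))"
    by simp
  moreover have "sh (pderiv F) = pderiv (sh F)" "sh [:0, 1:] = [:1, 1:]"
      "sh (monom 1 m) = [:1, 1:] ^ m"
    by (simp_all add: sh_def pderiv_pcompose pcompose_pCons pderiv_pCons pcompose_monom)
  ultimately have "Polynomial.smult c0 (sh (wp (\<delta> - M))) = - pCons 0 (pderiv (sh (wp (\<delta> - M))))
    + [:1, 1:] ^ m * (Polynomial.smult (of_nat \<alpha>) ([:1, 1:] * pderiv (sh F))
        + Polynomial.smult (of_int \<delta>) (sh F))"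
    by (simp only: sh_def pcompose_euler pcompose_add pcompose_mult[of "monom 1 m"]
        pcompose_mult[of "[:0, 1:]"] pcompose_smult)
  then have "coeff (Polynomial.smult c0 (sh (wp (\<delta> - M)))) p
      = coeff (- pCons 0 (pderiv (sh (wp (\<delta> - M))))
    + [:1, 1:] ^ m * (Polynomial.smult (of_nat \<alpha>) ([:1, 1:] * pderiv (sh F))
        + Polynomial.smult (of_int \<delta>) (sh F))) p"
    by simp
  then have "0 = coeff ([:1, 1:] ^ m * (Polynomial.smult (of_nat \<alpha>) ([:1, 1:] * pderiv (sh F))
      + Polynomial.smult (of_int \<delta>) (sh F))) p"
    by (simp only: coeff_add coeff_minus coeff_smult coeff_pCons_pderiv c0) simp
  also have "\<dots> = of_nat \<alpha> * coeff (pderiv (sh F) * [:1, 1:] ^ (m + 1)) p + of_int \<delta>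
      * coeff (sh F * [:1, 1:] ^ m) p"
    by (simp only: distrib_left mult_smult_left mult_smult_right coeff_add coeff_smult power_add
        power_one_right mult_ac)
  also have "coeff (sh F * [:1, 1:] ^ m) p = g"
    by (simp add: shF coeff_monom_mult coeff_0_power)
  \<comment> \<open>The term p g s^(p - 1) meets the linear coefficient m + 1 of (1 + s)^(m +
    1).\<close>
  also have "coeff (pderiv (sh F) * [:1, 1:] ^ (m + 1)) p = of_nat (p * (m + 1)) * g"
  proof -
    define Q :: "'k poly" where "Q = [:1, 1:] ^ (m + 1)"
    have "coeff Q 1 = of_nat (m + 1)"
      unfolding Q_def by (rule coeff_1_linear_power)
    then have "coeff (pderiv (sh F) * Q) p = of_nat p * g * of_nat (m + 1)"
      by (cases p) (simp_all add: shF pderiv_monom coeff_monom_mult monom_0)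
    then have "coeff (pderiv (sh F) * Q) p = of_nat (p * (m + 1)) * g"
      by (simp only: of_nat_mult mult_ac)
    then show ?thesis
      by (simp only: Q_def)
  qed
  finally have "(of_int (int (\<alpha> * (p * (m + 1))) + \<delta>) :: 'k) * g = 0"
    by (simp add: algebra_simps)
  then have sum0: "int (\<alpha> * (p * (m + 1))) + \<delta> = 0"
    using g by (simp only: mult_eq_0_iff of_int_eq_0_iff simp_thms)
  \<comment> \<open>The value of F at t = 0 is g (-1)^p, which is non-zero, so y^\<delta> occurs in
    \<open>f\<close> and \<delta> \<ge> 0.\<close>
  have "poly F 0 = poly (sh F) (-1)"
    by (simp add: sh_def poly_pcompose)
  then have "coeff F 0 \<noteq> 0"
    using g by (simp add: shF poly_monom poly_0_coeff_0)
  then have "\<delta> \<ge> 0"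
    using bcoeff_neg[of \<delta> f 0] by (cases "\<delta> < 0") (simp_all add: F_def wp_def coeff_weight_part)
  with sum0 have "\<alpha> * (p * (m + 1)) = 0"
    by linarith
  then have "p = 0"
    using \<alpha> by simp
  then have "bideriv m \<alpha> f = 0"
    by (simp add: darboux h \<open>h' = 0\<close> c0)
  then show ?thesis
    using bideriv_free_imp_const[OF m \<alpha>, of f] by simp
qed

section \<open>Stable ideals in two variables\<close>

lemma ex_irreducible_dvd_poly:
  fixes c :: "'k::field poly"
  assumes "degree c > 0"
  shows "\<exists>p. irreducible p \<and> p dvd c"
  using assms
proof (induction "degree c" arbitrary: c rule: less_induct)
  case less
  show ?case
  proof (cases "irreducible c")
    case False
    have "c \<noteq> 0"
      using less.prems by auto
    then have "\<not> c dvd 1"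
      using less.prems by (simp add: is_unit_iff_degree)
    then obtain a b where ab: "c = a * b" "\<not> a dvd 1" "\<not> b dvd 1"
      using False \<open>c \<noteq> 0\<close> unfolding irreducible_def by blast
    then have "a \<noteq> 0" "b \<noteq> 0"
      using \<open>c \<noteq> 0\<close> by auto
    then have "degree a > 0" "degree a < degree c"
      using ab by (auto simp: degree_mult_eq is_unit_iff_degree)
    from less.hyps[OF this(2,1)] show ?thesis
      using ab(1) by (auto intro: dvd_mult2)
  qed auto
qed

text \<open>Gauss's lemma: the prime elements of \<open>k[y]\<close> remain prime in \<open>k[y][x]\<close>.\<close>
lemma primitive_dvd_if_dvd_smult:
  fixes f h :: "'k::field poly poly"
  assumes prim: "\<And>p. prime_elem p \<Longrightarrow> \<not> [:p:] dvd f"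
    and "Polynomial.smult c h = f * q" and "c \<noteq> 0"
  shows "f dvd h"
  using assms(2,3)
proof (induction "degree c" arbitrary: c q rule: less_induct)
  case less
  show ?case
  proof (cases "degree c = 0")
    case True
    then obtain a where a: "c = [:a:]"
      by (rule degree_eq_zeroE)
    with less.prems have "a \<noteq> 0" by simp
    then have "h = Polynomial.smult [:1 / a:] (Polynomial.smult c h)"
      by (simp add: a flip: one_pCons)
    also have "\<dots> = f * Polynomial.smult [:1 / a:] q"
      by (simp add: less.prems)
    finally show ?thesis by (rule dvdI)
  next
    case False
    then obtain p where p: "irreducible p" "p dvd c"
      using ex_irreducible_dvd_poly by blast
    then have prime: "prime_elem p"
      by (simp add: field_poly_irreducible_imp_prime)
    obtain c' where c': "c = p * c'"
      using p(2) by (rule dvdE)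
    have "[:p:] dvd f * q"
      by (rule dvdI[of _ _ "Polynomial.smult c' h"])
          (simp add: less.prems(1)[symmetric] c' mult.commute)
    then have "[:p:] dvd q"
      using prim[OF prime] prime prime_elem_dvd_mult_iff[of "[:p:]"] prime_elem_const_poly_iff[of p]
          by blast
    then obtain q' where q': "q = [:p:] * q'"
      by (rule dvdE)
    have "p \<noteq> 0" "c' \<noteq> 0"
      using less.prems(2) c' by auto
    have "Polynomial.smult p (Polynomial.smult c' h) = Polynomial.smult p (f * q')"
      using less.prems(1) by (simp add: c' q')
    then have "Polynomial.smult c' h = f * q'"
      using \<open>p \<noteq> 0\<close> by (metis smult_cancel)
    moreover have "degree c' < degree c"
      using p(1) \<open>p \<noteq> 0\<close> \<open>c' \<noteq> 0\<close> by (auto simp: c' degree_mult_eq irreducible_def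
          is_unit_iff_degree)
    ultimately show ?thesis
      using less.hyps \<open>c' \<noteq> 0\<close> by blast
  qed
qed

lemma bideriv_monom:
  "bideriv m \<alpha> (monom p a) =
     (1 - monom (monom 1 \<alpha>) 1) * monom (of_nat a * p) (a - 1) + monom (pderiv p) (a + m)"
  by (simp add: bideriv_def pderiv_monom map_poly_monom mult_monom add.commute of_nat_poly)

lemma bideriv_stable_ideal_contains_1:
  fixes I :: "'k::field_char_0 poly poly set"
  assumes m: "m \<ge> 2" and \<alpha>: "\<alpha> \<ge> 1"
    and add: "\<And>f g. f \<in> I \<Longrightarrow> g \<in> I \<Longrightarrow> f + g \<in> I"
    and mult: "\<And>f g. f \<in> I \<Longrightarrow> g * f \<in> I"
    and stable: "\<And>f. f \<in> I \<Longrightarrow> bideriv m \<alpha> f \<in> I"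
    and nonzero: "f0 \<in> I" "f0 \<noteq> 0"
  shows "1 \<in> I"
proof -
  have diff: "f - g \<in> I" if "f \<in> I" "g \<in> I" for f g
    using add[OF that(1) mult[OF that(2), of "-1"]] by simp
  have smult: "Polynomial.smult s f \<in> I" if "f \<in> I" for s f
    using mult[OF that, of "[:s:]"] by simp
  \<comment> \<open>\<open>J\<close> is the intersection of \<open>k[y][x]\<close> with the ideal generated by \<open>I\<close> over \<open>k(y)\<close>.\<close>
  define J where "J = {f. \<exists>s. s \<noteq> 0 \<and> Polynomial.smult s f \<in> I}"
  have J_add: "f + g \<in> J" if fg: "f \<in> J" "g \<in> J" for f g
  proof -
    obtain s where s: "s \<noteq> 0" "Polynomial.smult s f \<in> I"
      using fg(1) unfolding J_def by blast
    obtain t where t: "t \<noteq> 0" "Polynomial.smult t g \<in> I"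
      using fg(2) unfolding J_def by blast
    have "Polynomial.smult t (Polynomial.smult s f) \<in> I"
        "Polynomial.smult s (Polynomial.smult t g) \<in> I"
      by (rule smult, fact)+
    then have "Polynomial.smult t (Polynomial.smult s f) + Polynomial.smult s (Polynomial.smult t g)
        \<in> I"
      by (rule add)
    then have "Polynomial.smult (s * t) (f + g) \<in> I"
      by (simp add: smult_add_right mult.commute)
    then show ?thesis
      using \<open>s \<noteq> 0\<close> \<open>t \<noteq> 0\<close> unfolding J_def by (auto intro!: exI[of _ "s * t"])
  qed
  have J_mult: "g * f \<in> J" if f: "f \<in> J" for f g
  proof -
    obtain s where s: "s \<noteq> 0" "Polynomial.smult s f \<in> I"
      using f unfolding J_def by blast
    then have "Polynomial.smult s (g * f) \<in> I"
      using mult[OF s(2), of g] by simp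
    with s(1) show ?thesis
      unfolding J_def by blast
  qed
  have J_diff: "f - g \<in> J" if "f \<in> J" "g \<in> J" for f g
    using J_add[OF that(1) J_mult[OF that(2), of "-1"]] by simp
  have J_stable: "bideriv m \<alpha> f \<in> J" if f: "f \<in> J" for f
  proof -
    obtain s where s: "s \<noteq> 0" "Polynomial.smult s f \<in> I"
      using f unfolding J_def by blast
    \<comment> \<open>Quotient rule with denominators cleared: s d(s f) - d(s) s f = s^2
      d(f).\<close>
    have "Polynomial.smult (s * s) (bideriv m \<alpha> f) = [:s:] * bideriv m \<alpha> ([:s:] * f)
        - bideriv m \<alpha> [:s:] * ([:s:] * f)"
      unfolding bideriv_mult by (simp add: algebra_simps smult_add_right)
    also have "\<dots> \<in> I"
    proof -
      have "[:s:] * f \<in> I"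
        using s(2) by simp
      from diff[OF mult[OF stable[OF this]] mult[OF this]] show ?thesis .
    qed
    finally show ?thesis
      using s(1) by (auto simp: J_def intro!: exI[of _ "s * s"])
  qed
  have "f0 \<in> J"
    using nonzero by (auto simp: J_def intro!: exI[of _ 1])
  then obtain f1 where f1: "f1 \<in> J \<and> f1 \<noteq> 0" "\<And>g. g \<in> J \<and> g \<noteq> 0 \<Longrightarrow> degree f1 \<le> degree g"
    using ex_has_least_nat[of "\<lambda>g. g \<in> J \<and> g \<noteq> 0" f0 degree] nonzero(2) by auto
  \<comment> \<open>Least degree in x makes the remainder of pseudo-division by \<open>f\<close>
    vanish. Least degree of the leading coefficient among these makes \<open>f\<close> primitive,
    since removing a common prime factor would lower it.\<close>
  obtain f where f: "f \<in> J" "f \<noteq> 0" "degree f = degree f1"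
    and f_min: "\<And>g. g \<in> J \<and> g \<noteq> 0 \<and> degree g = degree f1 \<Longrightarrow> degree (lead_coeff f)
        \<le> degree (lead_coeff g)"
    using ex_has_least_nat[of "\<lambda>g. g \<in> J \<and> g \<noteq> 0 \<and> degree g = degree f1" f1
        "\<lambda>g. degree (lead_coeff g)"] f1(1)
    by auto
  have "\<not> [:p:] dvd f" if "prime_elem p" for p
  proof
    assume "[:p:] dvd f"
    then obtain g where g: "f = Polynomial.smult p g" by (auto elim: dvdE)
    obtain s where "s \<noteq> 0" "Polynomial.smult s f \<in> I"
      using f(1) unfolding J_def by blast
    moreover have p: "p \<noteq> 0" "degree p > 0"
      using that by (auto simp: prime_elem_def is_unit_iff_degree)
    ultimately have "g \<in> J"
      using g by (auto simp: J_def intro!: exI[of _ "s * p"])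
    moreover have "g \<noteq> 0"
      using g f(2) by auto
    moreover have "degree g = degree f1"
      using f(3) g p by simp
    ultimately have "degree (lead_coeff f) \<le> degree (lead_coeff g)"
      using f_min by blast
    then show False
      using p \<open>g \<noteq> 0\<close> by (simp add: g lead_coeff_smult degree_mult_eq)
  qed
  moreover obtain q r where qr: "pseudo_divmod (bideriv m \<alpha> f) f = (q, r)"
    by fastforce
  define c where "c = lead_coeff f ^ (Suc (degree (bideriv m \<alpha> f)) - degree f)"
  have div: "Polynomial.smult c (bideriv m \<alpha> f) = f * q + r" "r = 0 \<or> degree r < degree f"
    using pseudo_divmod[OF f(2) qr] by (simp_all add: c_def)
  have "r = [:c:] * bideriv m \<alpha> f - q * f"
    using div(1) by (simp add: algebra_simps)
  then have "r \<in> J"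
    using f(1) by (simp only: J_diff J_mult J_stable)
  then have "r = 0"
    using div(2) f1(2)[of r] f(3) by (cases "r = 0") auto
  then have "Polynomial.smult c (bideriv m \<alpha> f) = f * q"
    using div by simp
  moreover have "c \<noteq> 0"
    using f(2) by (simp add: c_def)
  ultimately have "f dvd bideriv m \<alpha> f"
    by (rule primitive_dvd_if_dvd_smult)
  then obtain h where "bideriv m \<alpha> f = h * f"
    by (metis dvdE mult.commute)
  then obtain a where a: "f = [:[:a:]:]"
    using bideriv_darboux_imp_const[OF m \<alpha>] f(2) by blast
  then have "[:[:1 / a:]:] * f = 1"
    using f(2) by (simp add: one_pCons)
  then have "1 \<in> J"
    using J_mult[OF f(1)] by metis
  then obtain s where s: "s \<noteq> 0" "monom s 0 \<in> I"
    by (auto simp: J_def monom_0 one_pCons)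
  \<comment> \<open>Now \<open>I\<close> contains a non-zero element of k[y]. Among all p(y) x^a in
    \<open>I\<close>, one with p of least degree is taken.\<close>
  then obtain p where p: "p \<noteq> 0" "\<exists>a. monom p a \<in> I"
    and p_min: "\<And>q. q \<noteq> 0 \<and> (\<exists>a. monom q a \<in> I) \<Longrightarrow> degree p \<le> degree q"
    using ex_has_least_nat[of "\<lambda>p. p \<noteq> 0 \<and> (\<exists>a. monom p a \<in> I)" s degree] by auto
  obtain a where a: "monom p a \<in> I"
    using p(2) by blast
  have "monom 1 1 * monom (of_nat a * p) (a - 1) = of_nat a * monom p a"
    by (cases a) (simp_all add: mult_monom of_nat_poly smult_monom)
  \<comment> \<open>Multiplying the derivative by x and subtracting a multiple of p x^a leaves p'
    x^(a + m + 1). By minimality p' = 0, so p is constant in characteristic zero.\<close>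
  then have "monom (pderiv p) (a + m + 1)
      = monom 1 1 * bideriv m \<alpha> (monom p a) - (1 - monom (monom 1 \<alpha>) 1) * of_nat a * monom p a"
    by (simp add: bideriv_monom mult_monom distrib_left mult.left_commute mult.assoc)
  also have "\<dots> \<in> I"
    using a by (intro diff mult stable)
  finally have "degree p \<le> degree (pderiv p)" if "pderiv p \<noteq> 0"
    using p_min[of "pderiv p"] that by blast
  then have "pderiv p = 0"
    by (cases "pderiv p = 0") (auto simp: degree_pderiv pderiv_eq_0_iff)
  then obtain b where b: "p = [:b:]"
    by (metis degree_eq_zeroE pderiv_eq_0_iff)
  then have "monom 1 a = [:[:1 / b:]:] * monom p a"
    using p(1) by (simp add: smult_monom one_pCons)
  then have "monom 1 a \<in> I"
    using mult[OF a] by metis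
  then have "monom 1 (LEAST a. monom 1 a \<in> I) \<in> I"
    by (rule LeastI)
  moreover have "(LEAST a. monom 1 a \<in> I) = 0"
  proof (rule ccontr)
    define e where "e = (LEAST a. monom 1 a \<in> I)"
    assume "(LEAST a. monom 1 a \<in> I) \<noteq> 0"
    then obtain e' where e': "e = Suc e'"
      by (auto simp: e_def gr0_conv_Suc)
    have e: "monom 1 e \<in> I"
      using calculation by (simp add: e_def)
    \<comment> \<open>From d(x^e) = e x^(e - 1) - e y^\<alpha> x^e it follows that x^(e - 1) lies in
      \<open>I\<close>, against the choice of e.\<close>
    have "of_nat e * monom 1 e' = bideriv m \<alpha> (monom 1 e) + monom (monom 1 \<alpha>) 0 * of_nat e
        * monom 1 e"
      by (simp add: bideriv_monom e' mult_monom of_nat_poly smult_monom left_diff_distrib)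
    also have "\<dots> \<in> I"
      using e by (intro add mult stable)
    finally have "[:[:1 / of_nat e:]:] * (of_nat e * monom 1 e') \<in> I"
      by (rule mult)
    moreover have "[:[:1 / of_nat e:]:] * (of_nat e * monom 1 e') = (monom 1 e' :: 'k poly poly)"
      by (simp add: e' of_nat_poly smult_monom one_pCons del: of_nat_Suc)
    ultimately have "e \<le> e'"
      unfolding e_def by (intro Least_le) simp
    then show False
      by (simp add: e')
  qed
  ultimately show ?thesis
    by simp
qed

section \<open>Derivations of multivariate polynomials\<close>

lemma mpoly_eq_sum_single: "p = (\<Sum>e\<in>Poly_Mapping.keys p. Poly_Mapping.single e
    (Poly_Mapping.lookup p e))"
  for p :: "'a \<Rightarrow>\<^sub>0 'b::comm_monoid_add"
proof (rule poly_mapping_eqI)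
  fix e
  have "Poly_Mapping.lookup (\<Sum>e\<in>Poly_Mapping.keys p. Poly_Mapping.single e
      (Poly_Mapping.lookup p e)) e
      = (\<Sum>e'\<in>Poly_Mapping.keys p. if e' = e then Poly_Mapping.lookup p e else 0)"
    unfolding lookup_sum by (rule sum.cong) (auto simp: lookup_single when_def)
  then show "Poly_Mapping.lookup p e = Poly_Mapping.lookup
      (\<Sum>e\<in>Poly_Mapping.keys p. Poly_Mapping.single e (Poly_Mapping.lookup p e)) e"
    by (auto simp: not_in_keys_iff_lookup_eq_zero)
qed

text \<open>The case of a monomial may use that it occurs in \<open>p\<close>, which is what
  \<open>polys_in_induct\<close> needs; \<open>c = 0\<close> covers the empty sum.\<close>

lemma poly_mapping_additive_induct [case_names single add]:
  fixes p :: "'a \<Rightarrow>\<^sub>0 'b::comm_monoid_add"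
  assumes single: "\<And>e c. e \<in> Poly_Mapping.keys p \<or> c = 0 \<Longrightarrow> P (Poly_Mapping.single e c)"
    and add: "\<And>p q. P p \<Longrightarrow> P q \<Longrightarrow> P (p + q)"
  shows "P p"
proof -
  have "P (\<Sum>e\<in>A. Poly_Mapping.single e (Poly_Mapping.lookup p e))" if "A \<subseteq> Poly_Mapping.keys p"
      for A
    using finite_subset[OF that finite_keys] that
  proof (induction A rule: finite_induct)
    case empty
    then show ?case using single[of undefined 0] by simp
  next
    case (insert e A)
    then show ?case by (simp add: add single)
  qed
  then show ?thesis
    using mpoly_eq_sum_single[of p] by (metis subset_refl)
qed

lemma lookup_partial_deriv:
  "Poly_Mapping.lookup (partial_deriv i p) e = of_nat (Poly_Mapping.lookup e i + 1)
      * Poly_Mapping.lookup p (e + Poly_Mapping.single i 1)"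
proof -
  have eq: "e' - Poly_Mapping.single i 1 = e \<longleftrightarrow> e' = e + Poly_Mapping.single i 1" if
      "Poly_Mapping.lookup e' i \<noteq> 0" for e'
  proof -
    have "e' = (e' - Poly_Mapping.single i 1) + Poly_Mapping.single i 1"
      by (rule poly_mapping_eqI) (use that in \<open>auto simp: lookup_add lookup_minus lookup_single
          when_def\<close>)
    then show ?thesis
      by (metis add_diff_cancel_right')
  qed
  have "Poly_Mapping.lookup (partial_deriv i p) e = (\<Sum>e'\<in>Poly_Mapping.keys p.
      if e' = e + Poly_Mapping.single i 1 then of_nat (Poly_Mapping.lookup e' i)
          * Poly_Mapping.lookup p e' else 0)"
    unfolding partial_deriv_def lookup_sum
  proof (rule sum.cong)
    fix e'
    show "Poly_Mapping.lookup (Poly_Mapping.single (e'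
        - Poly_Mapping.single i 1) (of_nat (Poly_Mapping.lookup e' i) * Poly_Mapping.lookup p e')) e
      = (if e' = e + Poly_Mapping.single i 1 then of_nat (Poly_Mapping.lookup e' i)
          * Poly_Mapping.lookup p e' else 0)"
      using eq[of e'] by (cases "Poly_Mapping.lookup e' i = 0") (auto simp: lookup_single when_def)
  qed simp
  also have "\<dots> = of_nat (Poly_Mapping.lookup e i + 1)
      * Poly_Mapping.lookup p (e + Poly_Mapping.single i 1)"
    by (simp add: not_in_keys_iff_lookup_eq_zero[symmetric] lookup_add)
  finally show ?thesis .
qed

lemma partial_deriv_0 [simp]: "partial_deriv i 0 = 0"
  by (simp add: partial_deriv_def)

lemma partial_deriv_add: "partial_deriv i (p + q) = partial_deriv i p + partial_deriv i q"
  by (rule poly_mapping_eqI) (simp only: lookup_partial_deriv lookup_add distrib_left)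

lemma partial_deriv_single:
  "partial_deriv i (Poly_Mapping.single e c) =
     Poly_Mapping.single (e - Poly_Mapping.single i 1) (of_nat (Poly_Mapping.lookup e i) * c)"
  by (simp add: partial_deriv_def)

lemma partial_deriv_mult: "partial_deriv i (p * q) = p * partial_deriv i q + partial_deriv i p * q"
proof (induction p rule: poly_mapping_additive_induct)
  case (single e c)
  show ?case
  proof (induction q rule: poly_mapping_additive_induct)
    case (single e' c')
    let ?s = "Poly_Mapping.single i (1::nat)"
    have *: "a + (b - ?s) = a + b - ?s" if "Poly_Mapping.lookup b i \<noteq> 0" for a b :: "nat \<Rightarrow>\<^sub>0 nat"
      by (rule poly_mapping_eqI) (use that in \<open>auto simp: lookup_add lookup_minus lookup_single
          when_def\<close>)
    have "Poly_Mapping.single (e + (e' - ?s)) (c * (of_nat (Poly_Mapping.lookup e' i) * c'))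
        = Poly_Mapping.single (e + e' - ?s) (c * (of_nat (Poly_Mapping.lookup e' i) * c'))"
      using *[of e' e] by (cases "Poly_Mapping.lookup e' i = 0") simp_all
    moreover have "Poly_Mapping.single (e - ?s + e') (of_nat (Poly_Mapping.lookup e i) * c * c')
        = Poly_Mapping.single (e + e' - ?s) (of_nat (Poly_Mapping.lookup e i) * c * c')"
      using *[of e e'] by (cases "Poly_Mapping.lookup e i = 0") (simp_all add: add.commute)
    ultimately show ?case
      by (simp add: partial_deriv_single mult_single lookup_add single_add[symmetric] algebra_simps)
  next
    case (add p q)
    then show ?case by (simp add: distrib_left partial_deriv_add)
  qed
next
  case (add p q)
  then show ?case by (simp add: distrib_left distrib_right partial_deriv_add)
qed

lemma Const_0 [simp]: "Const 0 = 0"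
  by (simp add: Const_def)

lemma Const_1 [simp]: "Const 1 = 1"
  by (simp add: Const_def)

lemma Const_add: "Const (a + b) = Const a + Const b"
  by (simp add: Const_def single_add)

lemma Const_uminus: "Const (- a) = - Const a"
  by (simp add: Const_def single_uminus)

lemma Const_mult: "Const (a * b) = Const a * Const b"
  by (simp add: Const_def mult_single)

lemma Const_eq_0_iff [simp]: "Const c = 0 \<longleftrightarrow> c = 0"
  by (metis Const_0 Const_def lookup_single_eq lookup_zero)

lemma Const_of_nat: "Const (of_nat k) = of_nat k"
  by (simp add: Const_def)

lemma lookup_Const_mult_Var_add_Const:
  "Poly_Mapping.lookup (Const c * Var i + Const c') (Poly_Mapping.single i 1) = c"
  for c c' :: "'k::field"
proof -
  have "Poly_Mapping.single i (1::nat) \<noteq> 0"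
    by (metis lookup_single_eq lookup_zero zero_neq_one)
  then show ?thesis
    by (simp add: Const_def Var_def mult_single lookup_add lookup_single_not_eq)
qed

lemma Var_power: "Var i ^ k = Poly_Mapping.single (Poly_Mapping.single i k) (1::'k::field)"
  by (induction k) (simp_all add: Var_def mult_single flip: single_add)

lemma partial_deriv_Const [simp]: "partial_deriv i (Const c) = 0"
  by (simp add: Const_def partial_deriv_single)

lemma partial_deriv_1 [simp]: "partial_deriv i 1 = 0"
  using partial_deriv_Const[of i 1] by simp

lemma partial_deriv_Var: "partial_deriv i (Var j) = (if i = j then 1 else 0)"
  by (simp add: Var_def partial_deriv_single lookup_single when_def)

lemma d_n_add: "d_n n m \<alpha> (p + q) = d_n n m \<alpha> p + d_n n m \<alpha> q"
  by (simp add: d_n_def partial_deriv_add distrib_left sum.distrib)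

lemma d_n_mult: "d_n n m \<alpha> (p * q) = p * d_n n m \<alpha> q + d_n n m \<alpha> p * q"
proof -
  have "(\<Sum>i = 3..n. Var (i - 1) * partial_deriv i (p * q))
      = p * (\<Sum>i = 3..n. Var (i - 1) * partial_deriv i q)
          + (\<Sum>i = 3..n. Var (i - 1) * partial_deriv i p) * q"
    by (simp add: partial_deriv_mult sum_distrib_left sum_distrib_right distrib_left sum.distrib
        mult_ac)
  then show ?thesis
    by (simp add: d_n_def partial_deriv_mult algebra_simps)
qed

lemma d_n_Const [simp]: "d_n n m \<alpha> (Const c) = 0"
  by (simp add: d_n_def)

lemma d_n_0 [simp]: "d_n n m \<alpha> 0 = 0"
  by (simp add: d_n_def)

lemma d_n_1 [simp]: "d_n n m \<alpha> 1 = 0"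
  by (simp add: d_n_def)

lemma d_n_Var_1: "d_n n m \<alpha> (Var 1) = 1 - Var 1 * Var 2 ^ \<alpha>"
  by (simp add: d_n_def partial_deriv_Var)

lemma d_n_Var_2: "d_n n m \<alpha> (Var 2) = Var 1 ^ m"
  by (simp add: d_n_def partial_deriv_Var)

lemma d_n_Var_Suc:
  assumes "n \<ge> 2"
  shows "d_n (Suc n) m \<alpha> (Var (Suc n)) = Var n"
proof -
  have "(\<Sum>i = 3..Suc n. Var (i - 1) * partial_deriv i (Var (Suc n)))
      = (\<Sum>i = 3..Suc n. if i = Suc n then Var n else 0)"
    by (rule sum.cong) (auto simp: partial_deriv_Var)
  then show ?thesis
    using assms by (simp add: d_n_def partial_deriv_Var)
qed

section \<open>Polynomials in a prescribed set of variables\<close>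

definition polys_in :: "nat set \<Rightarrow> 'k::zero mpoly set" where
  "polys_in V = {p. \<forall>e \<in> Poly_Mapping.keys p. Poly_Mapping.keys e \<subseteq> V}"

lemma polys_in_induct [consumes 1, case_names single add]:
  fixes p :: "'k::comm_monoid_add mpoly"
  assumes "p \<in> polys_in V"
    and single: "\<And>e c. Poly_Mapping.keys e \<subseteq> V \<Longrightarrow> P (Poly_Mapping.single e c)"
    and add: "\<And>p q. P p \<Longrightarrow> P q \<Longrightarrow> P (p + q)"
  shows "P p"
proof (rule poly_mapping_additive_induct[of p])
  fix e and c :: 'k assume "e \<in> Poly_Mapping.keys p \<or> c = 0"
  then show "P (Poly_Mapping.single e c)"
    using assms(1) single[of e c] single[of 0 0] by (auto simp: polys_in_def)
qed (rule add)

lemma polys_in_mono: "V \<subseteq> W \<Longrightarrow> polys_in V \<subseteq> polys_in W"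
  by (auto simp: polys_in_def)

lemma polys_in_single: "Poly_Mapping.keys e \<subseteq> V \<Longrightarrow> Poly_Mapping.single e c \<in> polys_in V"
  by (auto simp: polys_in_def)

lemma polys_in_Const [simp]: "Const c \<in> polys_in V"
  by (auto simp: polys_in_def Const_def)

lemma polys_in_0 [simp]: "0 \<in> polys_in V"
  by (simp add: polys_in_def)

lemma polys_in_1 [simp]: "(1 :: 'k::field mpoly) \<in> polys_in V"
  by (simp add: polys_in_def)

lemma polys_in_Var [simp]: "i \<in> V \<Longrightarrow> (Var i :: 'k::field mpoly) \<in> polys_in V"
  by (simp add: polys_in_def Var_def)

lemma polys_in_add: "p \<in> polys_in V \<Longrightarrow> q \<in> polys_in V \<Longrightarrow> p + q \<in> polys_in V"
  using keys_add[of p q] by (fastforce simp: polys_in_def)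

lemma polys_in_mult:
  fixes p q :: "'k::field mpoly"
  assumes "p \<in> polys_in V" "q \<in> polys_in V"
  shows "p * q \<in> polys_in V"
  unfolding polys_in_def
proof (intro CollectI ballI)
  fix e assume "e \<in> Poly_Mapping.keys (p * q)"
  then obtain a b where "e = a + b" "a \<in> Poly_Mapping.keys p" "b \<in> Poly_Mapping.keys q"
    using keys_mult[of p q] by blast
  then show "Poly_Mapping.keys e \<subseteq> V"
    using assms keys_add[of a b] unfolding polys_in_def by blast
qed

lemma polys_in_uminus: "p \<in> polys_in V \<Longrightarrow> - p \<in> polys_in V" for p :: "'k::field mpoly"
  by (auto simp: polys_in_def in_keys_iff)

lemma polys_in_diff: "p \<in> polys_in V \<Longrightarrow> q \<in> polys_in V \<Longrightarrow> p - q \<in> polys_in V"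
    for p q :: "'k::field mpoly"
  using polys_in_add[of p V "- q"] polys_in_uminus[of q V] by simp

lemma polys_in_power: "p \<in> polys_in V \<Longrightarrow> p ^ k \<in> polys_in V" for p :: "'k::field mpoly"
  by (induction k) (auto intro: polys_in_mult)

lemma polys_in_sum: "(\<And>i. i \<in> A \<Longrightarrow> f i \<in> polys_in V) \<Longrightarrow> sum f A \<in> polys_in V"
  by (induction A rule: infinite_finite_induct) (auto intro: polys_in_add)

lemma polys_in_of_nat [simp]: "of_nat k \<in> polys_in V" for V :: "nat set"
  by (metis Const_of_nat polys_in_Const)

lemma polys_in_partial_deriv:
  assumes "p \<in> polys_in V"
  shows "partial_deriv i p \<in> polys_in V"
  unfolding polys_in_def
proof (intro CollectI ballI)
  fix e assume "e \<in> Poly_Mapping.keys (partial_deriv i p)"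
  then have "Poly_Mapping.lookup p (e + Poly_Mapping.single i 1) \<noteq> 0"
    unfolding in_keys_iff lookup_partial_deriv by (metis mult_zero_right)
  then have "e + Poly_Mapping.single i 1 \<in> Poly_Mapping.keys p"
    unfolding in_keys_iff .
  then have "Poly_Mapping.keys (e + Poly_Mapping.single i 1) \<subseteq> V"
    using assms unfolding polys_in_def by blast
  moreover have "Poly_Mapping.keys e \<subseteq> Poly_Mapping.keys (e + Poly_Mapping.single i 1)"
    by (auto simp: in_keys_iff lookup_add)
  ultimately show "Poly_Mapping.keys e \<subseteq> V"
    by blast
qed

lemma partial_deriv_eq_0: "p \<in> polys_in V \<Longrightarrow> i \<notin> V \<Longrightarrow> partial_deriv i p = 0"
proof (rule poly_mapping_eqI)
  fix e :: "nat \<Rightarrow>\<^sub>0 nat" assume "p \<in> polys_in V" "i \<notin> V"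
  moreover have "i \<in> Poly_Mapping.keys (e + Poly_Mapping.single i 1)"
    by (simp add: in_keys_iff lookup_add)
  ultimately have "e + Poly_Mapping.single i 1 \<notin> Poly_Mapping.keys p"
    unfolding polys_in_def by blast
  then show "Poly_Mapping.lookup (partial_deriv i p) e = Poly_Mapping.lookup 0 e"
    unfolding lookup_partial_deriv by (simp add: in_keys_iff)
qed

lemma polys_in_d_n:
  fixes p :: "'k::field mpoly"
  assumes "n \<ge> 2" "p \<in> polys_in {1..n}"
  shows "d_n n m \<alpha> p \<in> polys_in {1..n}"
proof -
  have "(Var (i - 1) :: 'k mpoly) \<in> polys_in {1..n}" if "i \<in> {3..n}" for i
    by (rule polys_in_Var) (use that in auto)
  then show ?thesis
    unfolding d_n_def using assms
    by (intro polys_in_add polys_in_mult polys_in_diff polys_in_power polys_in_sum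
        polys_in_partial_deriv) auto
qed

text \<open>The only additional summand contains the partial derivative by
  \<open>Var (Suc n)\<close>, a variable that does not occur in \<open>p\<close>.\<close>

lemma d_n_Suc:
  assumes "n \<ge> 2" "p \<in> polys_in {1..n}"
  shows "d_n (Suc n) m \<alpha> p = d_n n m \<alpha> p"
  using assms partial_deriv_eq_0[OF assms(2), of "Suc n"] by (simp add: d_n_def)

lemma polys_in_empty: "p \<in> polys_in {} \<longleftrightarrow> (\<exists>c. p = Const c)"
proof
  assume p: "p \<in> polys_in {}"
  have "p = Const (Poly_Mapping.lookup p 0)"
  proof (rule poly_mapping_eqI)
    fix e
    show "Poly_Mapping.lookup p e = Poly_Mapping.lookup (Const (Poly_Mapping.lookup p 0)) e"
    proof (cases "e = 0")
      case False
      then have "Poly_Mapping.keys e \<noteq> {}" by simp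
      then have "Poly_Mapping.lookup p e = 0"
        using p by (auto simp: polys_in_def in_keys_iff)
      then show ?thesis
        using False by (simp add: Const_def lookup_single)
    qed (simp add: Const_def)
  qed
  then show "\<exists>c. p = Const c" ..
qed auto

lemma lookup_mult_single: "Poly_Mapping.lookup (p * Poly_Mapping.single s 1) (e + s)
    = Poly_Mapping.lookup p e"
  for p :: "'k::field mpoly"
proof (induction p rule: poly_mapping_additive_induct)
  case (single e' c)
  then show ?case by (simp add: mult_single lookup_single when_def)
next
  case (add p q)
  then show ?case by (simp add: distrib_right lookup_add)
qed

section \<open>Adjoining one variable\<close>

lemma single_split:
  fixes c :: "'k::field"
  shows "Poly_Mapping.single e c =
    Poly_Mapping.single (e - Poly_Mapping.single v (Poly_Mapping.lookup e v)) c
        * Var v ^ Poly_Mapping.lookup e v"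
proof -
  have "e = e - Poly_Mapping.single v (Poly_Mapping.lookup e v)
      + Poly_Mapping.single v (Poly_Mapping.lookup e v)"
    by (rule poly_mapping_eqI) (simp add: lookup_add lookup_minus lookup_single when_def)
  then show ?thesis
    by (simp add: Var_power mult_single)
qed

text \<open>Together with \<open>poly_Var_eq_0_imp\<close> this gives existence and uniqueness of
  the expansion in powers of a new variable.\<close>

lemma polys_in_insert_imp_poly:
  fixes p :: "'k::field mpoly"
  assumes "p \<in> polys_in (insert v V)"
  shows "\<exists>q. (\<forall>i. coeff q i \<in> polys_in V) \<and> p = poly q (Var v)"
  using assms
proof (induction p rule: polys_in_induct)
  case (single e c)
  let ?e = "e - Poly_Mapping.single v (Poly_Mapping.lookup e v)"
  have "Poly_Mapping.keys ?e \<subseteq> Poly_Mapping.keys e - {v}"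
    by (auto simp: in_keys_iff lookup_minus lookup_single when_def)
  then have "Poly_Mapping.keys ?e \<subseteq> V"
    using single by blast
  then show ?case
    using single_split[of e c v]
    by (intro exI[of _ "monom (Poly_Mapping.single ?e c) (Poly_Mapping.lookup e v)"])
       (simp add: poly_monom coeff_monom polys_in_single)
next
  case (add p q)
  then obtain f g where "\<forall>i. coeff f i \<in> polys_in V" "p = poly f (Var v)"
    "\<forall>i. coeff g i \<in> polys_in V" "q = poly g (Var v)"
    by blast
  then show ?case
    by (intro exI[of _ "f + g"]) (simp add: polys_in_add)
qed

text \<open>A monomial in \<open>V\<close> times the i-th power of the new variable arises only from
  the i-th coefficient, because no coefficient involves that variable.\<close>

lemma poly_Var_eq_0_imp:
  fixes q :: "'k::field mpoly poly"
  assumes q: "\<And>i. coeff q i \<in> polys_in V" and v: "v \<notin> V" and zero: "poly q (Var v) = 0"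
  shows "q = 0"
proof (rule poly_eqI)
  fix i
  have "Poly_Mapping.lookup (coeff q i) e = 0" for e
  proof (cases "Poly_Mapping.keys e \<subseteq> V")
    case False
    then show ?thesis
      using q[of i] by (auto simp: polys_in_def in_keys_iff)
  next
    case True
    let ?e = "e + Poly_Mapping.single v i"
    have other: "Poly_Mapping.lookup (coeff q j
        * Poly_Mapping.single (Poly_Mapping.single v j) 1) ?e = 0" if ji: "j \<noteq> i" for j
    proof (rule ccontr)
      assume "\<not> ?thesis"
      then have "?e \<in> Poly_Mapping.keys (coeff q j
          * Poly_Mapping.single (Poly_Mapping.single v j) 1)"
        by (simp add: in_keys_iff)
      then obtain k where k: "k \<in> Poly_Mapping.keys (coeff q j)" "?e = k + Poly_Mapping.single v j"
        using keys_mult[of "coeff q j" "Poly_Mapping.single (Poly_Mapping.single v j) 1"]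
            by fastforce
      have "Poly_Mapping.keys k \<subseteq> V"
        using k(1) q[of j] by (auto simp: polys_in_def)
      then have "Poly_Mapping.lookup k v = 0" "Poly_Mapping.lookup e v = 0"
        using v True by (auto simp: in_keys_iff)
      then show False
        using arg_cong[OF k(2), of "\<lambda>e. Poly_Mapping.lookup e v"] ji by (simp add: lookup_add)
    qed
    have "Poly_Mapping.lookup (poly q (Var v)) ?e = (\<Sum>j\<le>degree q.
        Poly_Mapping.lookup (coeff q j * Poly_Mapping.single (Poly_Mapping.single v j) 1) ?e)"
      by (simp add: poly_altdef lookup_sum Var_power)
    also have "\<dots> = (\<Sum>j\<le>degree q. if j = i then Poly_Mapping.lookup (coeff q i) e else 0)"
    proof (rule sum.cong)
      fix j
      show "Poly_Mapping.lookup (coeff q j * Poly_Mapping.single (Poly_Mapping.single v j) 1) ?e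
          = (if j = i then Poly_Mapping.lookup (coeff q i) e else 0)"
        using other[of j] lookup_mult_single[of "coeff q j"] by (cases "j = i") auto
    qed simp
    finally have "Poly_Mapping.lookup (poly q (Var v)) ?e
        = (\<Sum>j\<le>degree q. if j = i then Poly_Mapping.lookup (coeff q i) e else 0)" .
    then show ?thesis
      using zero by (auto simp: coeff_eq_0 split: if_splits)
  qed
  then show "coeff q i = coeff 0 i"
    by (simp add: poly_mapping_eqI)
qed

lemma map_poly_additive:
  assumes "h 0 = 0" "\<And>a b. h (a + b) = h a + h b"
  shows "map_poly h (p + q) = map_poly h p + map_poly h q"
  by (rule poly_eqI) (simp add: coeff_map_poly assms)

lemma map_poly_multiplicative:
  fixes h :: "'a::comm_semiring_1 \<Rightarrow> 'b::comm_semiring_1"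
  assumes h: "h 0 = 0" "\<And>a b. h (a + b) = h a + h b" "\<And>a b. h (a * b) = h a * h b"
  shows "map_poly h (p * q) = map_poly h p * map_poly h q"
proof -
  have "h (sum f A) = (\<Sum>x\<in>A. h (f x))" for f and A :: "nat set"
    by (induction A rule: infinite_finite_induct) (simp_all add: h)
  then show ?thesis
    by (intro poly_eqI) (simp add: coeff_map_poly coeff_mult h)
qed

section \<open>Identification of k[y][x] with the ring in two variables\<close>

definition mpoly_of_poly :: "'k::field poly \<Rightarrow> 'k mpoly" where
  "mpoly_of_poly r = poly (map_poly Const r) (Var 2)"

definition mpoly_of_bipoly :: "'k::field poly poly \<Rightarrow> 'k mpoly" where
  "mpoly_of_bipoly f = poly (map_poly mpoly_of_poly f) (Var 1)"

lemma mpoly_of_poly_0 [simp]: "mpoly_of_poly 0 = 0"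
  by (simp add: mpoly_of_poly_def)

lemma mpoly_of_poly_add: "mpoly_of_poly (p + q) = mpoly_of_poly p + mpoly_of_poly q"
  by (simp add: mpoly_of_poly_def map_poly_additive Const_add)

lemma mpoly_of_poly_mult: "mpoly_of_poly (p * q) = mpoly_of_poly p * mpoly_of_poly q"
  by (simp add: mpoly_of_poly_def map_poly_multiplicative Const_add Const_mult)

lemma mpoly_of_poly_monom: "mpoly_of_poly (monom c k) = Const c * Var 2 ^ k"
  by (simp add: mpoly_of_poly_def map_poly_monom poly_monom)

lemma mpoly_of_bipoly_0 [simp]: "mpoly_of_bipoly 0 = 0"
  by (simp add: mpoly_of_bipoly_def)

lemma mpoly_of_bipoly_add: "mpoly_of_bipoly (p + q) = mpoly_of_bipoly p + mpoly_of_bipoly q"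
  by (simp add: mpoly_of_bipoly_def map_poly_additive mpoly_of_poly_add)

lemma mpoly_of_bipoly_mult: "mpoly_of_bipoly (p * q) = mpoly_of_bipoly p * mpoly_of_bipoly q"
  by (simp add: mpoly_of_bipoly_def map_poly_multiplicative mpoly_of_poly_add mpoly_of_poly_mult)

lemma mpoly_of_bipoly_monom:
  "mpoly_of_bipoly (monom (monom c l) k) = Const c * Var 2 ^ l * Var 1 ^ k"
  by (simp add: mpoly_of_bipoly_def map_poly_monom poly_monom mpoly_of_poly_monom)

lemma mpoly_of_poly_in: "mpoly_of_poly r \<in> polys_in {2}"
  unfolding mpoly_of_poly_def poly_altdef
  by (intro polys_in_sum polys_in_mult polys_in_power) (simp_all add: coeff_map_poly)

lemma mpoly_of_bipoly_in: "mpoly_of_bipoly f \<in> polys_in {1..2}"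
proof -
  have "mpoly_of_poly r \<in> polys_in {1..2}" for r :: "'a poly"
    using mpoly_of_poly_in[of r] polys_in_mono[of "{2}" "{1..2}"] by auto
  then show ?thesis
    unfolding mpoly_of_bipoly_def poly_altdef
    by (intro polys_in_sum polys_in_mult polys_in_power) (simp_all add: coeff_map_poly)
qed

lemma mpoly_of_bipoly_eq_0:
  assumes "mpoly_of_bipoly f = 0"
  shows "f = 0"
proof -
  have "map_poly mpoly_of_poly f = 0"
    using assms by (intro poly_Var_eq_0_imp[of _
        "{2}" 1]) (auto simp: mpoly_of_bipoly_def coeff_map_poly mpoly_of_poly_in)
  then have "mpoly_of_poly (coeff f i) = 0" for i
    by (metis coeff_0 coeff_map_poly mpoly_of_poly_0)
  then have "map_poly Const (coeff f i) = 0" for i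
    by (intro poly_Var_eq_0_imp[of _ "{}" 2]) (auto simp: mpoly_of_poly_def coeff_map_poly)
  then have "Const (coeff (coeff f i) j) = 0" for i j
    by (metis Const_0 coeff_0 coeff_map_poly)
  then show ?thesis
    by (simp add: poly_eq_iff)
qed

lemma mpoly_of_bipoly_inj: "mpoly_of_bipoly f = mpoly_of_bipoly g \<Longrightarrow> f = g"
proof -
  assume "mpoly_of_bipoly f = mpoly_of_bipoly g"
  moreover have "mpoly_of_bipoly f = mpoly_of_bipoly (f - g) + mpoly_of_bipoly g"
    using mpoly_of_bipoly_add[of "f - g" g] by simp
  ultimately show "f = g"
    using mpoly_of_bipoly_eq_0[of "f - g"] by simp
qed

lemma mpoly_of_bipoly_surj:
  assumes "p \<in> polys_in {1..2}"
  shows "\<exists>f. p = mpoly_of_bipoly f"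
  using assms
proof (induction p rule: polys_in_induct)
  case (single e c)
  let ?e = "Poly_Mapping.single 2 (Poly_Mapping.lookup e 2)
      + Poly_Mapping.single 1 (Poly_Mapping.lookup e 1)"
  have "e = ?e"
  proof (rule poly_mapping_eqI)
    fix i
    have "Poly_Mapping.lookup e i = 0" if "i \<noteq> 1" "i \<noteq> 2"
      using single that by (force simp: in_keys_iff)
    then show "Poly_Mapping.lookup e i = Poly_Mapping.lookup ?e i"
      by (auto simp: lookup_add lookup_single when_def)
  qed
  moreover have "Poly_Mapping.single ?e c
      = mpoly_of_bipoly (monom (monom c (Poly_Mapping.lookup e 2)) (Poly_Mapping.lookup e 1))"
    unfolding mpoly_of_bipoly_monom Var_power Const_def mult_single by simp
  ultimately show ?case
    by metis
next
  case (add p q)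
  then show ?case
    by (metis mpoly_of_bipoly_add)
qed

lemma mpoly_of_bipoly_1 [simp]: "mpoly_of_bipoly 1 = 1"
  using mpoly_of_bipoly_monom[of 1 0 0] by simp

lemma mpoly_of_bipoly_diff: "mpoly_of_bipoly (f - g) = mpoly_of_bipoly f - mpoly_of_bipoly g"
  using mpoly_of_bipoly_add[of "f - g" g] by simp

text \<open>Both sides obey the Leibniz rule along the ring homomorphism
  \<open>mpoly_of_bipoly\<close>, so it suffices to compare them on constants, y and x.\<close>

lemma mpoly_of_bipoly_bideriv:
  fixes f :: "'k::field_char_0 poly poly"
  shows "mpoly_of_bipoly (bideriv m \<alpha> f) = d_n 2 m \<alpha> (mpoly_of_bipoly f)"
proof -
  define P where "P = (\<lambda>f :: 'k poly poly. mpoly_of_bipoly (bideriv m \<alpha> f)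
      = d_n 2 m \<alpha> (mpoly_of_bipoly f))"
  have P_add: "P (f + g)" if "P f" "P g" for f g
    using that by (simp add: P_def bideriv_add mpoly_of_bipoly_add d_n_add)
  have P_mult: "P (f * g)" if "P f" "P g" for f g
    using that by (simp add: P_def bideriv_mult mpoly_of_bipoly_add mpoly_of_bipoly_mult d_n_mult)
  have P_const: "P (monom (monom c 0) 0)" for c
    unfolding P_def bideriv_monom mpoly_of_bipoly_monom by (simp add: pderiv_monom)
  have P_y: "P (monom (monom 1 1) 0)"
    unfolding P_def bideriv_monom mpoly_of_bipoly_monom
    using mpoly_of_bipoly_monom[of "1 :: 'k" 0 m]
    by (simp add: pderiv_monom d_n_Var_2 del: One_nat_def)
  have P_x: "P (monom (monom 1 0) 1)"
    unfolding P_def bideriv_monom mpoly_of_bipoly_monom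
    using mpoly_of_bipoly_monom[of "1 :: 'k" \<alpha> 1]
    by (simp add: pderiv_monom mpoly_of_bipoly_diff d_n_Var_1 mult.commute del: One_nat_def)
  have P_inner: "P [:a:]" for a
  proof (induction a)
    case 0
    show ?case using P_const[of 0] by simp
  next
    case (pCons c a)
    have "[:pCons c a:] = monom (monom c 0) 0 + monom (monom 1 1) 0 * [:a:]"
      by (simp add: monom_0 monom_Suc)
    then show ?case
      using P_add[OF P_const P_mult[OF P_y pCons.IH]] by simp
  qed
  have "P f"
  proof (induction f)
    case 0
    show ?case using P_inner[of 0] by simp
  next
    case (pCons a f)
    have "pCons a f = [:a:] + monom (monom 1 0) 1 * f"
      by (simp add: monom_0 monom_Suc flip: one_pCons)
    then show ?case
      using P_add[OF P_inner P_mult[OF P_x pCons.IH]] by simp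
  qed
  then show ?thesis by (simp add: P_def)
qed

lemma d_n_poly:
  "d_n n m \<alpha> (poly q x) = poly (map_poly (d_n n m \<alpha>) q
      + Polynomial.smult (d_n n m \<alpha> x) (pderiv q)) x"
proof (induction q)
  case (pCons a q)
  then show ?case
    by (simp add: d_n_add d_n_mult pderiv_pCons map_poly_pCons algebra_simps)
qed simp

lemma obtain_poly_Suc:
  fixes p :: "'k::field mpoly"
  assumes "p \<in> polys_in {1..Suc n}"
  obtains q where "\<And>i. coeff q i \<in> polys_in {1..n}" "p = poly q (Var (Suc n))"
  using polys_in_insert_imp_poly[of p "Suc n" "{1..n}"] assms by (auto simp: atLeastAtMostSuc_conv)

text \<open>The derivation acts on coefficients and sends the new variable to \<open>Var n\<close>.
  The inductions below compare the resulting coefficients degree by degree.\<close>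

lemma d_n_Suc_poly:
  fixes q :: "'k::field mpoly poly" and m \<alpha> :: nat
  assumes "n \<ge> 2" and q: "\<And>i. coeff q i \<in> polys_in {1..n}"
  defines "q' \<equiv> map_poly (d_n n m \<alpha>) q + Polynomial.smult (Var n) (pderiv q)"
  shows "d_n (Suc n) m \<alpha> (poly q (Var (Suc n))) = poly q' (Var (Suc n))"
    and "coeff q' i = d_n n m \<alpha> (coeff q i) + of_nat (Suc i) * (Var n * coeff q (Suc i))"
    and "coeff q' i \<in> polys_in {1..n}"
proof -
  have "map_poly (d_n (Suc n) m \<alpha>) q = map_poly (d_n n m \<alpha>) q"
    by (rule poly_eqI) (simp add: coeff_map_poly d_n_Suc[OF assms(1) q])
  then show "d_n (Suc n) m \<alpha> (poly q (Var (Suc n))) = poly q' (Var (Suc n))"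
    by (simp only: d_n_poly d_n_Var_Suc[OF assms(1)] q'_def)
  show coeff: "coeff q' i = d_n n m \<alpha> (coeff q i) + of_nat (Suc i) * (Var n * coeff q (Suc i))"
    by (simp add: q'_def coeff_map_poly coeff_pderiv mult_ac)
  show "coeff q' i \<in> polys_in {1..n}"
    unfolding coeff using assms(1)
    by (intro polys_in_add polys_in_mult polys_in_d_n q polys_in_Var polys_in_of_nat) auto
qed

section \<open>Induction on the number of variables\<close>

text \<open>The linear right-hand side is the form that survives induction: if the leading
  coefficient is a constant a, the coefficient below it, of degree i, has derivative b - (i + 1) a
  x_n with b constant. In two variables the right-hand side lies in k[y]. The case c = 0 serves for
  units, c \<noteq> 0 for stable ideals.\<close>

lemma d_n_eq_linear_imp_Const:
  fixes h :: "'k::field_char_0 mpoly"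
  assumes "n \<ge> 2" and m: "m \<ge> 2" and \<alpha>: "\<alpha> \<ge> 1"
    and "h \<in> polys_in {1..n}" "d_n n m \<alpha> h = Const c * Var n + Const c'"
  shows "\<exists>a. h = Const a"
  using assms(1,4,5)
proof (induction n arbitrary: h c c' rule: nat_induct_at_least)
  case base
  then obtain f where f: "h = mpoly_of_bipoly f"
    using mpoly_of_bipoly_surj[of h] by auto
  have "mpoly_of_bipoly (bideriv m \<alpha> f) = mpoly_of_bipoly (monom (monom c 1) 0
      + monom (monom c' 0) 0)"
    using base.prems(2) by (simp add: mpoly_of_bipoly_bideriv mpoly_of_bipoly_add
        mpoly_of_bipoly_monom f)
  then have "bideriv m \<alpha> f = monom (monom c 1) 0 + monom (monom c' 0) 0"
    by (rule mpoly_of_bipoly_inj)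
  then have "coeff (bideriv m \<alpha> f) i = 0" if "i \<ge> 1" for i
    using that by simp
  then obtain a where "f = [:[:a:]:]"
    using bideriv_free_imp_const[OF m \<alpha>, of f] by blast
  then show ?case
    using mpoly_of_bipoly_monom[of a 0 0] by (auto simp: f monom_0)
next
  case (Suc n)
  let ?x = "Var (Suc n) :: 'k mpoly"
  obtain q where q: "\<And>i. coeff q i \<in> polys_in {1..n}" "h = poly q ?x"
    using obtain_poly_Suc[OF Suc.prems(1)] by blast
  define q' where "q' = map_poly (d_n n m \<alpha>) q + Polynomial.smult (Var n) (pderiv q)"
  note q' = d_n_Suc_poly[OF Suc.hyps q(1), where m = m and \<alpha> = \<alpha>, folded q'_def]
  have "q' - [:Const c', Const c:] = 0"
  proof (rule poly_Var_eq_0_imp)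
    show "coeff (q' - [:Const c', Const c:]) i \<in> polys_in {1..n}" for i
      by (auto simp: coeff_pCons split: nat.split intro!: polys_in_diff q'(3)[simplified])
    show "poly (q' - [:Const c', Const c:]) ?x = 0"
      using Suc.prems(2) q(2) q'(1) by (simp add: mult.commute)
  qed auto
  then have "q' = [:Const c', Const c:]"
    by simp
  then have coeff_q': "\<exists>b. coeff q' i = Const b" for i
    by (auto simp: coeff_pCons split: nat.split intro: exI[of _ 0])
  have const_lead: "\<exists>a. lead_coeff q = Const a"
  proof -
    obtain b where "coeff q' (degree q) = Const b"
      using coeff_q' by blast
    then have "d_n n m \<alpha> (lead_coeff q) = Const 0 * Var n + Const b"
      using q'(2)[of "degree q"] by (simp add: coeff_eq_0)
    then show ?thesis
      using Suc.IH q(1) by blast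
  qed
  have "degree q = 0"
  proof (rule ccontr)
    assume "degree q \<noteq> 0"
    then obtain i where i: "degree q = Suc i"
      using not0_implies_Suc by blast
    obtain a where a: "coeff q (Suc i) = Const a"
      using const_lead i by auto
    obtain b where b: "coeff q' i = Const b"
      using coeff_q' by blast
    define e where "e = - (of_nat (Suc i) * a)"
    have e: "Const e = - (of_nat (Suc i) * Const a)"
      by (simp only: e_def Const_uminus Const_mult Const_of_nat)
    \<comment> \<open>The induction hypothesis makes this coefficient constant too, so its
      derivative is zero, whence a = 0.\<close>
    have "d_n n m \<alpha> (coeff q i) = Const e * Var n + Const b"
      using q'(2)[of i] unfolding a b e by (simp add: algebra_simps)
    moreover from this obtain a' where "coeff q i = Const a'"
      using Suc.IH q(1) by blast
    ultimately have "Const e * Var n + Const b = 0"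
      by (metis d_n_Const)
    then have "e = 0"
      using lookup_Const_mult_Var_add_Const[of e n b] by simp
    then have "a = 0"
      unfolding e_def by (simp del: of_nat_Suc)
    then have "lead_coeff q = 0"
      using a i by simp
    then have "q = 0"
      by (simp only: leading_coeff_0_iff)
    then show False
      using i by simp
  qed
  then have "h = lead_coeff q"
    unfolding q(2) by (auto elim!: degree_eq_zeroE)
  then show ?case
    using const_lead by simp
qed

lemma d_n_stable_ideal_contains_1:
  fixes I :: "'k::field_char_0 mpoly set"
  assumes "n \<ge> 2" and m: "m \<ge> 2" and \<alpha>: "\<alpha> \<ge> 1"
    and "I \<subseteq> polys_in {1..n}"
    and "\<And>p q. p \<in> I \<Longrightarrow> q \<in> I \<Longrightarrow> p + q \<in> I"
    and "\<And>p q. p \<in> I \<Longrightarrow> q \<in> polys_in {1..n} \<Longrightarrow> q * p \<in> I"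
    and "\<And>p. p \<in> I \<Longrightarrow> d_n n m \<alpha> p \<in> I"
    and "p0 \<in> I" "p0 \<noteq> 0"
  shows "1 \<in> I"
  using assms(1,4-9)
proof (induction n arbitrary: I p0 rule: nat_induct_at_least)
  case base
  define J where "J = {f. mpoly_of_bipoly f \<in> I}"
  obtain f0 where f0: "p0 = mpoly_of_bipoly f0"
    using mpoly_of_bipoly_surj[of p0] base.prems(1,5) by auto
  have "1 \<in> J"
  proof (rule bideriv_stable_ideal_contains_1[OF m \<alpha>])
    show "f + g \<in> J" if "f \<in> J" "g \<in> J" for f g
      using that base.prems(2) by (simp add: J_def mpoly_of_bipoly_add)
    show "g * f \<in> J" if "f \<in> J" for f g
      using that base.prems(3) mpoly_of_bipoly_in[of g] by (simp add: J_def mpoly_of_bipoly_mult)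
    show "bideriv m \<alpha> f \<in> J" if "f \<in> J" for f
      using that base.prems(4) by (simp add: J_def mpoly_of_bipoly_bideriv)
    show "f0 \<in> J" "f0 \<noteq> 0"
      using base.prems(5,6) f0 by (auto simp: J_def)
  qed
  then show ?case
    by (simp add: J_def)
next
  case (Suc n)
  let ?x = "Var (Suc n) :: 'k mpoly"
  have sub: "polys_in {1..n} \<subseteq> polys_in {1..Suc n}"
    by (rule polys_in_mono) auto
  define J where "J = {q. (\<forall>i. coeff q i \<in> polys_in {1..n}) \<and> poly q ?x \<in> I}"
  define D where "D = (\<lambda>q :: 'k mpoly poly. map_poly (d_n n m \<alpha>) q
      + Polynomial.smult (Var n) (pderiv q))"
  have J_D: "D q \<in> J" if "q \<in> J" for q
  proof -
    have q: "coeff q i \<in> polys_in {1..n}" for i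
      using that by (simp add: J_def)
    have "d_n (Suc n) m \<alpha> (poly q ?x) \<in> I"
      using Suc.prems(4) that by (simp add: J_def)
    then show ?thesis
      using d_n_Suc_poly(1,3)[OF Suc.hyps q, where m = m and \<alpha> = \<alpha>] by (simp add: J_def D_def)
  qed
  have coeff_D: "coeff (D q) i = d_n n m \<alpha> (coeff q i) + of_nat (Suc i) * (Var n * coeff q (Suc i))"
      if "q \<in> J" for q i
    using d_n_Suc_poly(2)[OF Suc.hyps, of q m \<alpha>] that by (simp add: J_def D_def)
  have J_add: "p + q \<in> J" if "p \<in> J" "q \<in> J" for p q
    using that Suc.prems(2) by (auto simp: J_def intro: polys_in_add)
  have J_smult: "Polynomial.smult a q \<in> J" if "q \<in> J" "a \<in> polys_in {1..n}" for a q
    using that Suc.prems(3) sub by (auto simp: J_def intro: polys_in_mult)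
  obtain q0 where q0: "q0 \<in> J" "q0 \<noteq> 0"
  proof -
    have "p0 \<in> polys_in {1..Suc n}"
      using Suc.prems(1,5) by blast
    then obtain q where q: "\<And>i. coeff q i \<in> polys_in {1..n}" "p0 = poly q ?x"
      using obtain_poly_Suc by blast
    then have "q \<noteq> 0"
      using Suc.prems(6) by auto
    moreover have "q \<in> J"
      using q Suc.prems(5) by (simp add: J_def)
    ultimately show ?thesis
      using that by blast
  qed
  obtain q1 where q1: "q1 \<in> J" "q1 \<noteq> 0" and q1_min: "\<And>q. q \<in> J \<and> q \<noteq> 0 \<Longrightarrow> degree q1 \<le> degree q"
    using ex_has_least_nat[of "\<lambda>q. q \<in> J \<and> q \<noteq> 0" q0 degree] q0 by auto
  define N where "N = degree q1"
  \<comment> \<open>Taking N-th coefficients of elements of degree at most N, instead of leading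
    coefficients, includes 0 and keeps \<open>L\<close> closed under addition.\<close>
  define L where "L = {a. \<exists>q\<in>J. degree q \<le> N \<and> coeff q N = a}"
  \<comment> \<open>\<open>D\<close> does not raise degrees and acts on N-th coefficients as
    \<open>d_n\<close>, so \<open>L\<close> is stable.\<close>
  have D_degree: "degree (D q) \<le> N" if "q \<in> J" "degree q \<le> N" for q
    by (rule degree_le) (use that in \<open>simp add: coeff_D coeff_eq_0\<close>)
  have "1 \<in> L"
  proof (rule Suc.IH)
    show "L \<subseteq> polys_in {1..n}"
      by (auto simp: L_def J_def)
    show "a + b \<in> L" if ab: "a \<in> L" "b \<in> L" for a b
    proof -
      obtain p q where "p \<in> J" "degree p \<le> N" "coeff p N = a" "q \<in> J" "degree q \<le> N" "coeff q N = b"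
        using ab by (auto simp: L_def)
      then show ?thesis
        unfolding L_def using J_add by (intro CollectI bexI[of _
            "p + q"]) (auto intro: degree_add_le)
    qed
    show "b * a \<in> L" if ab: "a \<in> L" "b \<in> polys_in {1..n}" for a b
    proof -
      obtain p where "p \<in> J" "degree p \<le> N" "coeff p N = a"
        using ab by (auto simp: L_def)
      then show ?thesis
        unfolding L_def using J_smult ab(2) degree_smult_le[of b p]
        by (intro CollectI bexI[of _ "Polynomial.smult b p"]) auto
    qed
    show "d_n n m \<alpha> a \<in> L" if a: "a \<in> L" for a
    proof -
      obtain p where "p \<in> J" "degree p \<le> N" "coeff p N = a"
        using a by (auto simp: L_def)
      then show ?thesis
        unfolding L_def using J_D D_degree
        by (intro CollectI bexI[of _ "D p"]) (auto simp: coeff_D coeff_eq_0)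
    qed
    show "lead_coeff q1 \<in> L" "lead_coeff q1 \<noteq> 0"
      using q1 by (auto simp: L_def N_def)
  qed
  then obtain q where q: "q \<in> J" "degree q \<le> N" "coeff q N = 1"
    by (auto simp: L_def)
  \<comment> \<open>The N-th coefficient of \<open>D q\<close> is the derivative of 1, hence zero;
    by minimality of N so is \<open>D q\<close>.\<close>
  have "D q = 0"
  proof (rule ccontr)
    assume "D q \<noteq> 0"
    then have "degree (D q) = N"
      using q1_min[of "D q"] J_D[OF q(1)] D_degree[OF q(1,2)] by (simp add: N_def)
    moreover have "coeff (D q) N = 0"
      using q by (simp add: coeff_D coeff_eq_0)
    ultimately show False
      using \<open>D q \<noteq> 0\<close> by (metis leading_coeff_0_iff)
  qed
  have "N = 0"
  proof (rule ccontr)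
    assume "N \<noteq> 0"
    then obtain i where i: "N = Suc i"
      using not0_implies_Suc by blast
    define e where "e = - (of_nat (Suc i) :: 'k)"
    have e: "Const e = - of_nat (Suc i)"
      by (simp only: e_def Const_uminus Const_of_nat)
    \<comment> \<open>The coefficient of degree N - 1 has derivative -N x_n, so it is constant and N
      = 0 in the field, which characteristic zero excludes.\<close>
    have "d_n n m \<alpha> (coeff q i) + of_nat (Suc i) * Var n = 0"
      using coeff_D[OF q(1), of i] \<open>D q = 0\<close> q(3) i by simp
    then have eq: "d_n n m \<alpha> (coeff q i) = Const e * Var n + Const 0"
      unfolding e by (simp add: eq_neg_iff_add_eq_0 del: of_nat_Suc)
    moreover obtain a where "coeff q i = Const a"
      using d_n_eq_linear_imp_Const[OF Suc.hyps m \<alpha> _ eq] q(1) by (auto simp: J_def)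
    ultimately have "Const e * Var n + Const 0 = 0"
      by (metis d_n_Const)
    then have "e = 0"
      by (metis lookup_Const_mult_Var_add_Const lookup_zero)
    then show False
      by (simp add: e_def del: of_nat_Suc)
  qed
  then have "q = [:1:]"
    using q by (metis degree_eq_zeroE coeff_pCons_0 le_zero_eq)
  then show ?case
    using q(1) by (simp add: J_def)
qed

text \<open>Degrees in the last variable add, since the coefficients form a domain, so both factors
  have degree 0 in it and induction applies.\<close>

lemma polys_in_unit_imp_Const:
  fixes u w :: "'k::field mpoly"
  assumes "u \<in> polys_in {1..n}" "w \<in> polys_in {1..n}" "u * w = 1"
  shows "\<exists>c. u = Const c"
  using assms
proof (induction n arbitrary: u w)
  case 0
  then show ?case by (simp add: polys_in_empty)
next
  case (Suc n)
  obtain q where q: "\<And>i. coeff q i \<in> polys_in {1..n}" "u = poly q (Var (Suc n))"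
    using obtain_poly_Suc[OF Suc.prems(1)] by blast
  obtain r where r: "\<And>i. coeff r i \<in> polys_in {1..n}" "w = poly r (Var (Suc n))"
    using obtain_poly_Suc[OF Suc.prems(2)] by blast
  have "q * r - 1 = 0"
  proof (rule poly_Var_eq_0_imp)
    show "coeff (q * r - 1) i \<in> polys_in {1..n}" for i
      unfolding coeff_diff coeff_mult
      by (intro polys_in_diff polys_in_sum polys_in_mult q r) simp
    show "poly (q * r - 1) (Var (Suc n)) = 0"
      using Suc.prems(3) q(2) r(2) by simp
  qed auto
  then have qr: "q * r = 1"
    by simp
  then have "degree (q * r) = 0" "q \<noteq> 0" "r \<noteq> 0"
    by auto
  then have "degree q = 0" "degree r = 0"
    by (auto simp: degree_mult_eq)
  then obtain a b where ab: "q = [:a:]" "r = [:b:]"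
    by (metis degree_eq_zeroE)
  then have "a * b = 1"
    using qr by (simp add: one_pCons mult.commute)
  moreover have "a \<in> polys_in {1..n}" "b \<in> polys_in {1..n}"
    using q(1)[of 0] r(1)[of 0] ab by auto
  ultimately show ?case
    using Suc.IH q(2) ab by auto
qed

section \<open>The polynomial ring as an algebra, and the theorem\<close>

lemma mpoly_algebra_simps:
  "carrier (mpoly_algebra n) = polys_in {1..n}"
  "p \<otimes>\<^bsub>mpoly_algebra n\<^esub> q = p * q" "p \<oplus>\<^bsub>mpoly_algebra n\<^esub> q = p + q"
  "\<one>\<^bsub>mpoly_algebra n\<^esub> = 1" "\<zero>\<^bsub>mpoly_algebra n\<^esub> = 0"
  "c \<odot>\<^bsub>mpoly_algebra n\<^esub> p = Const c * p"
  by (simp_all add: mpoly_algebra_def polys_in_def)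

lemma cring_coeff_field: "cring (coeff_field :: 'k::field ring)"
proof (rule cringI)
  show "abelian_group (coeff_field :: 'k ring)"
    by (rule abelian_groupI) (auto simp: coeff_field_def add_eq_0_iff2 intro: exI[of _ "- _"])
  show "comm_monoid (coeff_field :: 'k ring)"
    by (rule comm_monoidI) (auto simp: coeff_field_def)
qed (auto simp: coeff_field_def distrib_right)

lemma cring_mpoly_algebra: "cring (mpoly_algebra n :: ('k::field, 'k mpoly) module)"
proof (rule cringI)
  show "abelian_group (mpoly_algebra n :: ('k, 'k mpoly) module)"
  proof (rule abelian_groupI)
    fix p assume "p \<in> carrier (mpoly_algebra n :: ('k, 'k mpoly) module)"
    then show "\<exists>q\<in>carrier (mpoly_algebra n). q \<oplus>\<^bsub>mpoly_algebra n\<^esub> p = \<zero>\<^bsub>mpoly_algebra n\<^esub>"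
      by (intro bexI[of _ "- p"]) (auto simp: mpoly_algebra_simps intro: polys_in_uminus)
  qed (auto simp: mpoly_algebra_simps intro: polys_in_add)
  show "comm_monoid (mpoly_algebra n :: ('k, 'k mpoly) module)"
    by (rule comm_monoidI) (auto simp: mpoly_algebra_simps mult_ac intro: polys_in_mult)
qed (auto simp: mpoly_algebra_simps distrib_right)

lemma k_derivation_d_n:
  assumes "n \<ge> 2"
  shows "k_derivation (coeff_field :: 'k::field ring) (mpoly_algebra n) (d_n n m \<alpha>)"
proof (intro k_derivation.intro k_derivation_axioms.intro)
  show "algebra (coeff_field :: 'k ring) (mpoly_algebra n)"
    by (rule algebraI[OF cring_coeff_field cring_mpoly_algebra])
       (auto simp: mpoly_algebra_simps coeff_field_def Const_add Const_mult algebra_simps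
           intro: polys_in_mult)
qed (use assms in \<open>auto simp: mpoly_algebra_simps d_n_add d_n_mult simp del: One_nat_def
    intro: polys_in_d_n\<close>)

theorem theorem1p1:
  fixes n m \<alpha> :: nat
  assumes "n \<ge> 2" and "m \<ge> 2" and "\<alpha> \<ge> 1"
  shows "simple_k_derivation (coeff_field :: 'k::field_char_0 ring) (mpoly_algebra n) (d_n n m \<alpha>) \<and>
    \<not> (\<exists>u \<in> Units (mpoly_algebra n :: ('k, 'k mpoly) module). u \<in> d_n n m \<alpha> ` carrier (mpoly_algebra n))"
proof
  let ?R = "mpoly_algebra n :: ('k, 'k mpoly) module"
  show "simple_k_derivation (coeff_field :: 'k ring) ?R (d_n n m \<alpha>)"
  proof (intro simple_k_derivation.intro simple_k_derivation_axioms.intro)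
    show "k_derivation (coeff_field :: 'k ring) ?R (d_n n m \<alpha>)"
      by (rule k_derivation_d_n[OF assms(1)])
    fix I assume I: "ideal I ?R" "d_n n m \<alpha> ` I \<subseteq> I"
    interpret I: ideal I ?R by (rule I(1))
    note I_subgroup = ideal.axioms(1)[OF I(1)]
    have "0 \<in> I"
      using additive_subgroup.zero_closed[OF I_subgroup] by (simp add: mpoly_algebra_simps)
    moreover have "1 \<in> I" if "p \<in> I" "p \<noteq> 0" for p
    proof (rule d_n_stable_ideal_contains_1[OF assms])
      show "I \<subseteq> polys_in {1..n}"
        using additive_subgroup.a_subset[OF I_subgroup] by (simp add: mpoly_algebra_simps)
      show "p + q \<in> I" if "p \<in> I" "q \<in> I" for p q
        using additive_subgroup.a_closed[OF I_subgroup that] by (simp add: mpoly_algebra_simps)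
      show "q * p \<in> I" if "p \<in> I" "q \<in> polys_in {1..n}" for p q
        using I.I_l_closed[OF that(1), of q] that(2) by (simp add: mpoly_algebra_simps)
      show "d_n n m \<alpha> p \<in> I" if "p \<in> I" for p
        using I(2) that by blast
    qed fact+
    ultimately show "I = {\<zero>\<^bsub>?R\<^esub>} \<or> I = carrier ?R"
      using I.one_imp_carrier by (auto simp: mpoly_algebra_simps)
  qed
  show "\<not> (\<exists>u \<in> Units ?R. u \<in> d_n n m \<alpha> ` carrier ?R)"
  proof
    assume "\<exists>u \<in> Units ?R. u \<in> d_n n m \<alpha> ` carrier ?R"
    then obtain h where "h \<in> carrier ?R" and unit: "d_n n m \<alpha> h \<in> Units ?R"
      by blast
    then have h: "h \<in> polys_in {1..n}" "d_n n m \<alpha> h \<in> polys_in {1..n}"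
      by (simp_all only: Units_def mpoly_algebra_simps mem_Collect_eq)
    obtain w where w: "w \<in> polys_in {1..n}" "d_n n m \<alpha> h * w = 1"
      using unit unfolding Units_def mpoly_algebra_simps by blast
    obtain c where "d_n n m \<alpha> h = Const c"
      using polys_in_unit_imp_Const[OF h(2) w] by blast
    \<comment> \<open>With coefficient 0 at x_n the linear case applies: \<open>h\<close> is
      constant, and the supposed unit is zero.\<close>
    then have "d_n n m \<alpha> h = Const 0 * Var n + Const c"
      by simp
    from d_n_eq_linear_imp_Const[OF assms h(1) this] have "d_n n m \<alpha> h = 0"
      by auto
    then show False
      using w(2) by simp
  qed
qed

end
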